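(* Let $F,G,I,S,j_a,j_b,a_e,b_o$ be as in the context, where $F(x)=x^{n+1}+\sum_{k=0}^{n}b_kx^k$ and $G(x)=-Ax^m-\sum_{k=0}^{m-1}a_kx^k$ satisfy $F(0)=F'(0)=0$, $F'(x)/x>0$ for all $x\in\mathbb R$, $G(0)=0$, $G(x)/x<0$ for all $x\in\mathbb R$, and at least one of $j_a$ and $j_b$ is well-defined. Assume that $m>2n+1$ and that $I_-(+\infty)-I_+(+\infty)=0$ (i.e. $I(y)$ converges to $0$ as $y\to+\infty$). Then the following statements hold. 1. Suppose that $n-2j_b<m-2j_a$ or $a_e=0$. Then, for each $y_0$ sufficiently large, the orbit $U$ of $y_0$ by $S$ (resp. $S^{-1}$) tends to $+\infty$ for $b_{2j_b+1}<0$ (resp. $b_{2j_b+1}>0$), $U$ is Minkowski nondegenerate and $$\dim_BU=\frac{(n-2j_b)(m+1)}{(n-2j_b)(m+1)+2(n+1)}.$$ 2. Suppose that $n-2j_b>m-2j_a$ or $b_o=0$. Then, for each $y_0$ sufficiently large, the orbit $U$ of $y_0$ by $S$ (resp. $S^{-1}$) tends to $+\infty$ for $a_{2j_a}>0$ (resp. $a_{2j_a}<0$), $U$ is Minkowski nondegenerate and $$\dim_BU=\frac{(m-2j_a)(m+1)}{(m-2j_a)(m+1)+2(n+1)}.$$ 3. Suppose that $n-2j_b=m-2j_a$ and $C:=b_{2j_b+1}(m-n+2j_b+1)-a_{2j_a}(n+1)\neq0$. Then, for each $y_0$ sufficiently large, the orbit $U$ of $y_0$ by $S$ (resp. $S^{-1}$)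 tends to $+\infty$ for $C<0$ (resp. $C>0$), $U$ is Minkowski nondegenerate and $$\dim_BU=\frac{(n-2j_b)(m+1)}{(n-2j_b)(m+1)+2(n+1)}=\frac{(m-2j_a)(m+1)}{(m-2j_a)(m+1)+2(n+1)}.$$
   Context: Setting. Consider the slow-fast Liénard system $\dot x=y-F(x)$, $\dot y=\epsilon G(x)$, $0\le\epsilon\ll1$, where $F(x)=x^{n+1}+\sum_{k=0}^{n}b_kx^k$ and $G(x)=-Ax^m-\sum_{k=0}^{m-1}a_kx^k$ are real polynomials, $m,n\ge1$ integers. The normalization (for $m\ne2n+1$) is: $A=1$ if $m$ is even; $A\in\{-1,1\}$ if $m$ is odd. The assumptions $F(0)=F'(0)=0$, $F'(x)/x>0$ for all $x\in\mathbb R$, $G(0)=0$, $G(x)/x<0$ for all $x\in\mathbb R$ are understood with $F'(x)/x$ and $G(x)/x$ regarded as polynomials (so also at $x=0$, i.e. $F''(0)>0$, $G'(0)<0$). They imply that $m$ and $n$ are odd, $b_0=b_1=a_0=0$ and $A=1$. Slow divergence integrals. For $y>0$ let $\omega(y)>0$ and $\alpha(y)<0$ be the unique numbers with $F(\omega(y))=F(\alpha(y))=y$ (and $\omega(0)=\alpha(0)=0$). Put $$I_-(y)=-\int_{\omega(y)}^{0}\frac{F'(x)^2}{G(x)}\,dx,\qquad I_+(y)=-\int_{\alpha(y)}^{0}\frac{F'(x)^2}{G(x)}\,dx,\qquad I(y)=I_-(y)-I_+(y).$$ The functions $I_\pm$ are strictly decreasing with $I_\pm(0)=0$, and, for $m>2n+1$,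 $I_\pm(y)$ converge to finite negative numbers, denoted $I_\pm(+\infty)$, as $y\to+\infty$. Slow relation function. When $I_-(+\infty)=I_+(+\infty)$, $S:[0,\infty)\to[0,\infty)$ is defined by $I_-(y)=I_+(S(y))$, and $S^{-1}$ is its inverse. The orbit of $y_0>0$ by $S$ is $U=\{y_l=S^l(y_0)\mid l\in\mathbb N\}$ ($S^l$ the $l$-fold composition); the orbit by $S^{-1}$ is defined in the same way with $S^{-1}$ in place of $S$. "$U$ tends to $+\infty$" means $y_l\to+\infty$ as $l\to\infty$. "For each $y_0$ sufficiently large" means: there is $M>0$ such that the assertion holds for every $y_0>M$. Coefficients. If some odd-index coefficient $b_{2j+1}$ ($0\le j\le\frac{n-1}{2}$) of $F$ is nonzero, $j_b$ is the maximal $j$ with $b_{2j+1}\neq0$; otherwise $j_b$ is not defined and we write $b_o=0$. If some even-index coefficient $a_{2j}$ ($0\le j\le\frac{m-1}{2}$) is nonzero, $j_a$ is the maximal $j$ with $a_{2j}\neq0$; otherwise $j_a$ is not defined and we write $a_e=0$. A condition comparing $n-2j_b$ with $m-2j_a$ presupposes that both $j_a$ and $j_b$ are defined. Minkowski dimension. For bounded $V\subset\mathbb R$ and $\delta>0$ let $V_\delta=\{x\in\mathbb R\mid d(x,V)\le\delta\}$ with Lebesgue measure $|V_\delta|$. For $s\ge0$ put $\mathcal M_*^s(V)=\liminf_{\delta\to0}|V_\delta|/\delta^{1-s}$ and $\mathcal M^{*s}(V)=\limsup_{\delta\to0}|V_\delta|/\delta^{1-s}$. The lower and upper Minkowski dimensions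 are $\underline{\dim}_BV=\inf\{s\ge0\mid\mathcal M_*^s(V)=0\}$, $\overline{\dim}_BV=\inf\{s\ge0\mid\mathcal M^{*s}(V)=0\}$; if equal, the common value is $\dim_BV$. $V$ is Minkowski nondegenerate if $0<\mathcal M_*^d(V)\le\mathcal M^{*d}(V)<\infty$ for some $d$ (then $d=\dim_BV$). For an orbit $U=\{y_l\}$ with $y_l\to+\infty$ and $m>2n+1$, the lower and upper Minkowski dimensions of $U$ are by definition those of the bounded set $\{y_l^{-2/(m+1)}\mid l\in\mathbb N\}$, $\dim_BU$ is their common value when they agree, and $U$ is called Minkowski nondegenerate if $\{y_l^{-2/(m+1)}\mid l\in\mathbb N\}$ is. *)

theory Defs
  imports "HOL-Analysis.Analysis" "HOL-Computational_Algebra.Polynomial"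
begin

text \<open>The Lienard system is given by real polynomials \<open>F\<close> and \<open>G\<close>; \<open>y\<close> ranges over
  \<open>[0, \<infinity>)\<close>.\<close>

definition omega :: "real poly \<Rightarrow> real \<Rightarrow> real" where
  "omega F y = (if y = 0 then 0 else (THE x. x > 0 \<and> poly F x = y))"

definition alpha :: "real poly \<Rightarrow> real \<Rightarrow> real" where
  "alpha F y = (if y = 0 then 0 else (THE x. x < 0 \<and> poly F x = y))"

text \<open>The integrals are oriented. The integrand is 0 at \<open>x = 0\<close> (as \<open>0 / 0 = 0\<close>), which is
  also its continuous extension when \<open>F'\<close> and \<open>G\<close> have a simple zero there.\<close>

definition I_minus :: "real poly \<Rightarrow> real poly \<Rightarrow> real \<Rightarrow> real" where
  "I_minus F G y = - (LBINT x = omega F y..0. (poly (pderiv F) x)\<^sup>2 / poly G x)"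

definition I_plus :: "real poly \<Rightarrow> real poly \<Rightarrow> real \<Rightarrow> real" where
  "I_plus F G y = - (LBINT x = alpha F y..0. (poly (pderiv F) x)\<^sup>2 / poly G x)"

definition slow_div_integral :: "real poly \<Rightarrow> real poly \<Rightarrow> real \<Rightarrow> real" where
  "slow_div_integral F G y = I_minus F G y - I_plus F G y"

text \<open>The slow relation function and its inverse, as maps of \<open>[0, \<infinity>)\<close>; their values at
  negative arguments carry no meaning.\<close>

definition slow_rel :: "real poly \<Rightarrow> real poly \<Rightarrow> real \<Rightarrow> real" where
  "slow_rel F G y = (THE s. s \<ge> 0 \<and> I_minus F G y = I_plus F G s)"

definition slow_rel_inv :: "real poly \<Rightarrow> real poly \<Rightarrow> real \<Rightarrow> real" where
  "slow_rel_inv F G = inv_into {0..} (slow_rel F G)"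

text \<open>Indices of the nonzero odd coefficients \<open>b\<^sub>2\<^sub>j\<^sub>+\<^sub>1\<close> of \<open>F\<close> and of the nonzero even
  coefficients \<open>a\<^sub>2\<^sub>j\<close> of \<open>G\<close>. The numbers \<open>jb\<close> and \<open>ja\<close> are meaningful
  only if the respective set is nonempty; \<open>b\<^sub>o = 0\<close> and \<open>a\<^sub>e = 0\<close> say that it is empty.\<close>

definition odd_support :: "nat \<Rightarrow> (nat \<Rightarrow> real) \<Rightarrow> nat set" where
  "odd_support n b = {j. 2 * j + 1 \<le> n \<and> b (2 * j + 1) \<noteq> 0}"

definition even_support :: "nat \<Rightarrow> (nat \<Rightarrow> real) \<Rightarrow> nat set" where
  "even_support m a = {j. 2 * j + 1 \<le> m \<and> a (2 * j) \<noteq> 0}"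

definition jb :: "nat \<Rightarrow> (nat \<Rightarrow> real) \<Rightarrow> nat" where
  "jb n b = Max (odd_support n b)"

definition ja :: "nat \<Rightarrow> (nat \<Rightarrow> real) \<Rightarrow> nat" where
  "ja m a = Max (even_support m a)"

text \<open>Minkowski contents and dimensions of nonempty bounded subsets of the real line.\<close>

definition thickening :: "real set \<Rightarrow> real \<Rightarrow> real set" where
  "thickening V \<delta> = {x. infdist x V \<le> \<delta>}"

definition lower_content :: "real \<Rightarrow> real set \<Rightarrow> ennreal" where
  "lower_content s V =
     Liminf (at_right 0) (\<lambda>\<delta>. emeasure lebesgue (thickening V \<delta>) / ennreal (\<delta> powr (1 - s)))"

definition upper_content :: "real \<Rightarrow> real set \<Rightarrow> ennreal" where
  "upper_content s V =
     Limsup (at_right 0) (\<lambda>\<delta>. emeasure lebesgue (thickening V \<delta>) / ennreal (\<delta> powr (1 - s)))"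

definition lower_minkowski_dim :: "real set \<Rightarrow> real" where
  "lower_minkowski_dim V = Inf {s. s \<ge> 0 \<and> lower_content s V = 0}"

definition upper_minkowski_dim :: "real set \<Rightarrow> real" where
  "upper_minkowski_dim V = Inf {s. s \<ge> 0 \<and> upper_content s V = 0}"

definition has_minkowski_dim :: "real set \<Rightarrow> real \<Rightarrow> bool" where
  "has_minkowski_dim V d \<longleftrightarrow> lower_minkowski_dim V = d \<and> upper_minkowski_dim V = d"

definition minkowski_nondegenerate :: "real set \<Rightarrow> bool" where
  "minkowski_nondegenerate V \<longleftrightarrow>
     (\<exists>d\<ge>0. 0 < lower_content d V \<and> lower_content d V \<le> upper_content d V
           \<and> upper_content d V < \<infinity>)"

text \<open>Fractal properties of an orbit tending to infinity are those of its image under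
  \<open>y \<mapsto> y\<^bsup>-2/(m+1)\<^esup>\<close>.\<close>

definition orbit_near_zero :: "nat \<Rightarrow> (nat \<Rightarrow> real) \<Rightarrow> real set" where
  "orbit_near_zero m y = range (\<lambda>l. y l powr (- 2 / (real m + 1)))"

definition orbit :: "(real \<Rightarrow> real) \<Rightarrow> real \<Rightarrow> nat \<Rightarrow> real" where
  "orbit T y0 l = (T ^^ l) y0"

text \<open>For each sufficiently large \<open>y0\<close>, the orbit of \<open>y0\<close> by \<open>T\<close> tends to infinity, is
  Minkowski nondegenerate and has Minkowski dimension \<open>d\<close>.\<close>

definition large_orbits_have_dim :: "nat \<Rightarrow> (real \<Rightarrow> real) \<Rightarrow> real \<Rightarrow> bool" where
  "large_orbits_have_dim m T d \<longleftrightarrow>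
     (\<exists>M>0. \<forall>y0>M.
        filterlim (orbit T y0) at_top sequentially
        \<and> minkowski_nondegenerate (orbit_near_zero m (orbit T y0))
        \<and> has_minkowski_dim (orbit_near_zero m (orbit T y0)) d)"

end

theory Submission
  imports Defs
begin

text \<open>With \<open>h = F' / G\<close> one has \<open>I\<^sub>-'(y) = h(\<omega>(y))\<close> and \<open>I\<^sub>+'(y) = h(\<alpha>(y))\<close>. Let \<open>r\<close> be the smaller of
  \<open>n - 2 j\<^sub>b\<close> and \<open>m - 2 j\<^sub>a\<close>, the distance from the leading terms to the first coefficients that
  break the symmetry \<open>x \<mapsto> - x\<close>. Then \<open>I'(y)\<close> is asymptotic to \<open>- 2 K y\<^bsup>-(m-n+r)/(n+1)\<^esup>\<close> with an explicit
  constant \<open>K\<close>, while \<open>I\<^sub>\<plusminus>'(y)\<close> is asymptotic to \<open>- (n+1) y\<^bsup>-(m-n)/(n+1)\<^esup>\<close>. As \<open>I\<close> vanishes at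
  infinity, integration and the mean value theorem show that \<open>S(y) - y\<close> (if \<open>K < 0\<close>) or
  \<open>S\<^sup>-\<^sup>1(y) - y\<close> (if \<open>K > 0\<close>) is positive of exact order \<open>y\<^bsup>1-r/(n+1)\<^esup>\<close>. In the coordinate
  \<open>u = y\<^bsup>-2/(m+1)\<^esup>\<close> the gaps of an orbit are of exact order \<open>u\<^bsup>1+s\<^esup>\<close> with \<open>s = r (m+1) / (2 (n+1))\<close>. Such
  a sequence has Minkowski dimension \<open>s / (1+s)\<close>: at scale \<open>\<delta>\<close> the neighbourhood consists of an
  interval of length about \<open>\<delta>\<^bsup>1/(1+s)\<^esup>\<close> at 0 and about \<open>\<delta>\<^bsup>-s/(1+s)\<^esup>\<close> intervals of length about \<open>\<delta>\<close>.\<close>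

section \<open>Minkowski dimension of sequences with power-law gaps\<close>

text \<open>Dividing by \<open>\<delta> powr (1 - s)\<close> only shifts the exponent to
  \<open>s - d\<close>, so one two-sided estimate controls the quotients for every \<open>s\<close>
  at once.\<close>

lemma content_ratio_bounds:
  fixes V :: "real set" and d c c' :: real
  assumes "\<forall>\<^sub>F \<delta> in at_right 0. ennreal (c * \<delta> powr (1 - d)) \<le> emeasure lebesgue (thickening V \<delta>)
      \<and> emeasure lebesgue (thickening V \<delta>) \<le> ennreal (c' * \<delta> powr (1 - d))"
    and "0 \<le> c" "0 \<le> c'"
  shows "\<forall>\<^sub>F \<delta> in at_right 0.
      ennreal (c * \<delta> powr (s - d)) \<le> emeasure lebesgue (thickening V \<delta>) / ennreal (\<delta> powr (1 - s))
      \<and> emeasure lebesgue (thickening V \<delta>) / ennreal (\<delta> powr (1 - s)) \<le> ennreal (c' * \<delta> powr (s - d))"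
  using assms(1) eventually_at_right_less[of "0::real"]
proof eventually_elim
  case (elim \<delta>)
  have eq: "ennreal (k * \<delta> powr (s - d)) = ennreal (k * \<delta> powr (1 - d)) / ennreal (\<delta> powr (1 - s))"
    if "0 \<le> k" for k
  proof -
    have "k * \<delta> powr (1 - d) / \<delta> powr (1 - s) = k * \<delta> powr (s - d)"
      using powr_diff[of \<delta> "1 - d" "1 - s"] by simp
    then show ?thesis
      using elim that by (simp add: divide_ennreal)
  qed
  show ?case
    unfolding eq[OF assms(2)] eq[OF assms(3)] using elim by (intro conjI divide_right_mono_ennreal) auto
qed

text \<open>For \<open>s \<le> d\<close> the quotients eventually stay above \<open>c\<close>, as
  \<open>\<delta> < 1\<close>; for \<open>s > d\<close> they tend to 0. Hence both contents vanish
  exactly for \<open>s > d\<close>, both infima are \<open>d\<close>, and at \<open>s = d\<close>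
  the contents are positive and finite.\<close>

lemma minkowski_dim_of_content_bounds:
  fixes V :: "real set" and d c c' :: real
  assumes bounds: "\<forall>\<^sub>F \<delta> in at_right 0.
        ennreal (c * \<delta> powr (1 - d)) \<le> emeasure lebesgue (thickening V \<delta>)
      \<and> emeasure lebesgue (thickening V \<delta>) \<le> ennreal (c' * \<delta> powr (1 - d))"
    and c: "0 < c" "0 \<le> c'" and d: "0 \<le> d"
  shows "minkowski_nondegenerate V \<and> has_minkowski_dim V d"
proof -
  note ratio = content_ratio_bounds[OF bounds less_imp_le[OF c(1)] c(2)]
  have nt: "at_right (0::real) \<noteq> bot"
    by simp
  have le: "lower_content s V \<le> upper_content s V" for s
    unfolding lower_content_def upper_content_def by (rule Liminf_le_Limsup[OF nt])
  have low: "ennreal c \<le> lower_content s V" if "s \<le> d" for s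
    unfolding lower_content_def
  proof (rule Liminf_bounded)
    have "\<forall>\<^sub>F \<delta> in at_right (0::real). \<delta> < 1"
      by (rule eventually_at_right_real[of 0 1, THEN eventually_mono]) auto
    then show "\<forall>\<^sub>F \<delta> in at_right 0. ennreal c \<le> emeasure lebesgue (thickening V \<delta>) / ennreal (\<delta> powr (1 - s))"
      using ratio[of s] eventually_at_right_less[of "0::real"]
    proof eventually_elim
      case (elim \<delta>)
      have "\<delta> powr 0 \<le> \<delta> powr (s - d)"
        using elim that by (intro powr_mono') auto
      then have "c \<le> c * \<delta> powr (s - d)"
        using c elim by simp
      then show ?case
        using elim by (meson ennreal_leI order_trans)
    qed
  qed
  have up: "upper_content d V \<le> ennreal c'"
    unfolding upper_content_def
  proof (rule Limsup_bounded)
    show "\<forall>\<^sub>F \<delta> in at_right 0. emeasure lebesgue (thickening V \<delta>) / ennreal (\<delta> powr (1 - d)) \<le> ennreal c'"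
      using ratio[of d] eventually_at_right_less[of "0::real"]
      by eventually_elim simp
  qed
  have zero: "upper_content s V = 0" if "d < s" for s
  proof -
    have "((\<lambda>\<delta>. c' * \<delta> powr (s - d)) \<longlongrightarrow> c' * 0 powr (s - d)) (at_right 0)"
      using that by (intro tendsto_intros) (auto simp: eventually_at_filter)
    then have "((\<lambda>\<delta>. ennreal (c' * \<delta> powr (s - d))) \<longlongrightarrow> ennreal 0) (at_right 0)"
      using that by (intro tendsto_ennrealI) simp
    then have "Limsup (at_right 0) (\<lambda>\<delta>. ennreal (c' * \<delta> powr (s - d))) = 0"
      using lim_imp_Limsup[OF nt] by simp
    moreover have "upper_content s V \<le> Limsup (at_right 0) (\<lambda>\<delta>. ennreal (c' * \<delta> powr (s - d)))"
      unfolding upper_content_def using ratio[of s] by (intro Limsup_mono) (auto elim: eventually_mono)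
    ultimately show ?thesis
      by simp
  qed
  have pos: "0 < lower_content s V" if "s \<le> d" for s
    using low[OF that] c by (meson ennreal_less_zero_iff less_le_trans)
  have low_iff: "lower_content s V = 0 \<longleftrightarrow> d < s" for s
    using zero[of s] pos[of s] le[of s] by (cases "d < s") auto
  have up_iff: "upper_content s V = 0 \<longleftrightarrow> d < s" for s
    using zero[of s] pos[of s] le[of s] by (cases "d < s") auto
  have "{s. s \<ge> 0 \<and> lower_content s V = 0} = {d<..}" "{s. s \<ge> 0 \<and> upper_content s V = 0} = {d<..}"
    using d by (auto simp: low_iff up_iff)
  then have "has_minkowski_dim V d"
    by (simp add: has_minkowski_dim_def lower_minkowski_dim_def upper_minkowski_dim_def)
  moreover have "minkowski_nondegenerate V"
    unfolding minkowski_nondegenerate_def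
    using d pos[of d] le[of d] up by (intro exI[of _ d]) (auto simp: less_top[symmetric] top_unique)
  ultimately show ?thesis
    by simp
qed

lemma thickening_sets_lebesgue: "thickening V \<delta> \<in> sets lebesgue"
proof -
  have "closed (thickening V \<delta>)"
    unfolding thickening_def by (intro closed_Collect_le continuous_intros)
  then show ?thesis
    by (simp add: borel_closed)
qed

text \<open>The lower bound refers to the larger end of a gap and the upper bound to the smaller
  end, the stronger choice in both cases. The former limits the number of terms above a threshold,
  the latter the length of the gaps below it.\<close>

locale gap_sequence =
  fixes u :: "nat \<Rightarrow> real" and s c1 c2 :: real
  assumes s: "0 < s" and c1: "0 < c1" and c2: "0 < c2"
    and u_pos: "\<And>k. 0 < u k"
    and gap_lower: "\<And>k. c1 * u k powr (1 + s) \<le> u k - u (Suc k)"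
    and gap_upper: "\<And>k. u k - u (Suc k) \<le> c2 * u (Suc k) powr (1 + s)"
begin

lemma decreasing: "u (Suc k) < u k"
proof -
  have "0 < c1 * u k powr (1 + s)"
    using c1 u_pos[of k] by simp
  then show ?thesis
    using gap_lower[of k] by linarith
qed

text \<open>Under \<open>u \<mapsto> u\<^bsup>-s\<^esup>\<close> the gaps become bounded below, by the mean value theorem.\<close>

lemma neg_powr_step: "u k powr (- s) + s * c1 \<le> u (Suc k) powr (- s)"
proof -
  have "\<exists>z>u (Suc k). z < u k \<and>
      u k powr (- s) - u (Suc k) powr (- s) = (u k - u (Suc k)) * (- s * z powr (- s - 1))"
    using u_pos[of "Suc k"] decreasing[of k]
    by (intro MVT2) (auto intro!: derivative_eq_intros simp: field_simps powr_diff)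
  then obtain z where z: "u (Suc k) < z" "z < u k"
    and eq: "u k powr (- s) - u (Suc k) powr (- s) = (u k - u (Suc k)) * (- s * z powr (- s - 1))"
    by blast
  \<comment> \<open>The factor at \<open>z\<close> is replaced by its smaller value at
    \<open>u k\<close>, which cancels \<open>u k powr (1 + s)\<close> from the lower gap
    bound.\<close>
  have "u k powr (- s - 1) \<le> z powr (- s - 1)"
    using z u_pos[of "Suc k"] s by (intro powr_mono2') auto
  then have "c1 * u k powr (1 + s) * u k powr (- s - 1) \<le> (u k - u (Suc k)) * z powr (- s - 1)"
    using gap_lower[of k] decreasing[of k] c1 by (intro mult_mono) auto
  moreover have "u k powr (1 + s) * u k powr (- s - 1) = 1"
    using u_pos[of k] by (simp add: powr_add[symmetric])
  ultimately have "c1 \<le> (u k - u (Suc k)) * z powr (- s - 1)"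
    by (simp add: mult.assoc)
  then have "s * c1 \<le> s * ((u k - u (Suc k)) * z powr (- s - 1))"
    using s by simp
  then show ?thesis
    using eq by (simp add: algebra_simps)
qed

lemma neg_powr_ge: "s * c1 * real k \<le> u k powr (- s)"
proof (induction k)
  case (Suc k)
  then show ?case
    using neg_powr_step[of k] by (simp add: algebra_simps)
qed simp

text \<open>Only about \<open>t powr (- s)\<close> terms can be at least \<open>t\<close>, since
  \<open>u k powr (- s)\<close> grows at least linearly in \<open>k\<close>.\<close>

lemma index_le: 
  assumes "0 < t" "t \<le> u k" shows "real k \<le> t powr (- s) / (s * c1)"
proof -
  have "u k powr (- s) \<le> t powr (- s)"
    using assms s by (intro powr_mono2') auto
  then show ?thesis
    using neg_powr_ge[of k] s c1 by (simp add: field_simps)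
qed

lemma tendsto_zero: "u \<longlonglongrightarrow> 0"
proof (rule LIMSEQ_I)
  fix e :: real assume e: "0 < e"
  obtain N :: nat where N: "e powr (- s) / (s * c1) < N"
    using reals_Archimedean2 by blast
  have "u k < e" if "N \<le> k" for k
    using index_le[OF e, of k] N that by fastforce
  then show "\<exists>N. \<forall>k\<ge>N. norm (u k - 0) < e"
    using u_pos by (metis abs_of_pos diff_zero real_norm_def)
qed

lemma bracket:
  assumes "0 < x" "x \<le> u 0"
  obtains k where "u (Suc k) < x" "x \<le> u k"
proof -
  have "\<exists>k. u k < x"
    using order_tendstoD(2)[OF tendsto_zero assms(1)] by (meson eventually_sequentially order_refl)
  then obtain k where k: "u k < x" "\<And>j. j < k \<Longrightarrow> \<not> u j < x"
    using exists_least_iff[of "\<lambda>k. u k < x"] by blast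
  then show ?thesis
    using assms that[of "k - 1"] by (cases k) (auto simp: not_less)
qed

text \<open>Below \<open>t\<close> all gaps have length at most \<open>\<delta>\<close>, so the
  neighbourhood leaves no hole there.\<close>

lemma thickening_supset:
  assumes t: "t \<le> u 0" and \<delta>: "c2 * t powr (1 + s) \<le> \<delta>"
  shows "{0<..t} \<subseteq> thickening (range u) \<delta>"
proof
  fix x assume x: "x \<in> {0<..t}"
  then obtain k where k: "u (Suc k) < x" "x \<le> u k"
    using bracket[of x] t by auto
  have "x - u (Suc k) \<le> c2 * u (Suc k) powr (1 + s)"
    using k gap_upper[of k] by linarith
  also have "\<dots> \<le> c2 * t powr (1 + s)"
    using c2 k x u_pos[of "Suc k"] s by (intro mult_left_mono powr_mono2) auto
  finally have "dist x (u (Suc k)) \<le> \<delta>"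
    using k \<delta> by (simp add: dist_real_def)
  then have "infdist x (range u) \<le> \<delta>"
    by (intro infdist_le2[of "u (Suc k)"]) auto
  then show "x \<in> thickening (range u) \<delta>"
    by (simp add: thickening_def)
qed

text \<open>The terms up to \<open>t\<close> share one interval; each of the terms above
  \<open>t\<close>, whose indices \<open>index_le\<close> bounds, gets an interval of its
  own.\<close>

lemma thickening_subset:
  assumes t: "0 < t" and \<delta>: "0 < \<delta>"
  shows "thickening (range u) \<delta> \<subseteq>
    {- 2 * \<delta>..t + 2 * \<delta>} \<union> (\<Union>k\<le>nat \<lfloor>t powr (- s) / (s * c1)\<rfloor>. {u k - 2 * \<delta>..u k + 2 * \<delta>})"
proof
  fix x assume "x \<in> thickening (range u) \<delta>"
  \<comment> \<open>Doubling the radius makes the inequality strict, so that some term of the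
    sequence realizes it even if the infimum is not attained.\<close>
  then have "infdist x (range u) < 2 * \<delta>"
    using \<delta> by (simp add: thickening_def)
  then obtain k where k: "dist x (u k) < 2 * \<delta>"
    by (auto simp: infdist_def cINF_less_iff)
  show "x \<in> {- 2 * \<delta>..t + 2 * \<delta>} \<union> (\<Union>k\<le>nat \<lfloor>t powr (- s) / (s * c1)\<rfloor>. {u k - 2 * \<delta>..u k + 2 * \<delta>})"
  proof (cases "u k \<le> t")
    case True
    then show ?thesis
      using k u_pos[of k] by (auto simp: dist_real_def)
  next
    case False
    then have "k \<le> nat \<lfloor>t powr (- s) / (s * c1)\<rfloor>"
      using index_le[OF t, of k] by linarith
    then show ?thesis
      using k by (intro UnI2) (auto simp: dist_real_def intro!: bexI[of _ k])
  qed
qed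

lemma thickening_le:
  assumes t: "0 < t" and \<delta>: "0 < \<delta>"
  shows "emeasure lebesgue (thickening (range u) \<delta>)
    \<le> ennreal (t + 4 * \<delta> + (1 + t powr (- s) / (s * c1)) * (4 * \<delta>))"
proof -
  define N where "N = nat \<lfloor>t powr (- s) / (s * c1)\<rfloor>"
  have N: "real N \<le> t powr (- s) / (s * c1)"
    using s c1 by (simp add: N_def)
  have "emeasure lebesgue (thickening (range u) \<delta>) \<le>
      emeasure lebesgue ({- 2 * \<delta>..t + 2 * \<delta>} \<union> (\<Union>k\<le>N. {u k - 2 * \<delta>..u k + 2 * \<delta>}))"
    using thickening_subset[OF t \<delta>] by (intro emeasure_mono) (auto simp: N_def)
  also have "\<dots> \<le> emeasure lebesgue {- 2 * \<delta>..t + 2 * \<delta>} + emeasure lebesgue (\<Union>k\<le>N. {u k - 2 * \<delta>..u k + 2 * \<delta>})"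
    by (intro emeasure_subadditive) auto
  also have "\<dots> \<le> emeasure lebesgue {- 2 * \<delta>..t + 2 * \<delta>} + (\<Sum>k\<le>N. emeasure lebesgue {u k - 2 * \<delta>..u k + 2 * \<delta>})"
    by (intro add_left_mono emeasure_subadditive_finite) auto
  also have "\<dots> = ennreal (t + 4 * \<delta>) + (\<Sum>k\<le>N. ennreal (4 * \<delta>))"
    using t \<delta> by simp
  also have "\<dots> = ennreal (t + 4 * \<delta> + (1 + real N) * (4 * \<delta>))"
    using t \<delta> by (subst sum_ennreal) (auto simp: ennreal_plus[symmetric] algebra_simps simp del: ennreal_plus)
  also have "\<dots> \<le> ennreal (t + 4 * \<delta> + (1 + t powr (- s) / (s * c1)) * (4 * \<delta>))"
    using N \<delta> by (intro ennreal_leI add_left_mono mult_right_mono) auto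
  finally show ?thesis .
qed

lemma content_lower:
  "\<forall>\<^sub>F \<delta> in at_right 0. ennreal (c2 powr (- 1 / (1 + s)) * \<delta> powr (1 / (1 + s)))
     \<le> emeasure lebesgue (thickening (range u) \<delta>)"
proof -
  \<comment> \<open>\<open>T \<delta>\<close> solves \<open>c2 * t powr (1 + s) = \<delta>\<close>:
    it is the threshold below which the gaps are filled.\<close>
  define T where "T \<delta> = c2 powr (- 1 / (1 + s)) * \<delta> powr (1 / (1 + s))" for \<delta> :: real
  have "(T \<longlongrightarrow> c2 powr (- 1 / (1 + s)) * 0 powr (1 / (1 + s))) (at_right 0)"
    unfolding T_def using s by (intro tendsto_intros) (auto simp: eventually_at_filter)
  then have "(T \<longlongrightarrow> 0) (at_right 0)"
    using s by simp
  then have "\<forall>\<^sub>F \<delta> in at_right 0. T \<delta> < u 0"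
    using order_tendstoD(2) u_pos by blast
  then show ?thesis
    using eventually_at_right_less[of "0::real"]
  proof eventually_elim
    case (elim \<delta>)
    have "T \<delta> powr (1 + s) = c2 powr (- 1) * \<delta> powr 1"
      unfolding T_def using s elim by (subst powr_mult) (auto simp: powr_powr)
    then have "c2 * T \<delta> powr (1 + s) \<le> \<delta>"
      using c2 elim by (simp add: powr_minus_divide)
    moreover have "T \<delta> \<ge> 0"
      by (simp add: T_def)
    ultimately have "emeasure lebesgue {0<..T \<delta>} \<le> emeasure lebesgue (thickening (range u) \<delta>)"
      using elim by (intro emeasure_mono thickening_supset thickening_sets_lebesgue) auto
    then show ?case
      using \<open>T \<delta> \<ge> 0\<close> by (simp add: T_def)
  qed
qed

lemma content_upper:
  "\<forall>\<^sub>F \<delta> in at_right 0. emeasure lebesgue (thickening (range u) \<delta>)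
     \<le> ennreal ((9 + 4 / (s * c1)) * \<delta> powr (1 / (1 + s)))"
proof -
  have "\<forall>\<^sub>F \<delta> in at_right (0::real). \<delta> < 1"
    by (rule eventually_at_right_real[of 0 1, THEN eventually_mono]) auto
  then show ?thesis
    using eventually_at_right_less[of "0::real"]
  proof eventually_elim
    case (elim \<delta>)
    \<comment> \<open>This threshold balances the length \<open>t\<close> of the interval at 0
      against the total length of order \<open>t powr (- s) * \<delta>\<close> of the separate
      intervals. With \<open>\<delta> \<le> t\<close>, the constant 9 collects
      \<open>t + 4 * \<delta> + 4 * \<delta>\<close>.\<close>
    define t where "t = \<delta> powr (1 / (1 + s))"
    have "t powr (- s) * \<delta> = \<delta> powr (- s / (1 + s)) * \<delta> powr 1"
      using elim by (simp add: t_def powr_powr)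
    also have "\<dots> = \<delta> powr (1 + - s / (1 + s))"
      by (subst powr_add[symmetric]) (simp add: add.commute)
    also have "1 + - s / (1 + s) = 1 / (1 + s)"
      using s by (simp add: field_simps)
    finally have "t powr (- s) * \<delta> = t"
      by (simp add: t_def)
    moreover have "\<delta> powr 1 \<le> t"
      unfolding t_def using elim s by (intro powr_mono') auto
    moreover have "(1 + t powr (- s) / (s * c1)) * (4 * \<delta>) = 4 * \<delta> + 4 / (s * c1) * (t powr (- s) * \<delta>)"
      by (simp add: algebra_simps)
    ultimately have "t + 4 * \<delta> + (1 + t powr (- s) / (s * c1)) * (4 * \<delta>) \<le> (9 + 4 / (s * c1)) * t"
      unfolding distrib_right[of 9] by simp
    moreover have "0 < t"
      using elim by (simp add: t_def)
    ultimately show ?case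
      using thickening_le[of t \<delta>] elim unfolding t_def by (meson ennreal_leI order_trans)
  qed
qed

lemma minkowski_dim:
  "minkowski_nondegenerate (range u) \<and> has_minkowski_dim (range u) (s / (1 + s))"
proof (rule minkowski_dim_of_content_bounds)
  have "1 - s / (1 + s) = 1 / (1 + s)"
    using s by (simp add: field_simps)
  then show "\<forall>\<^sub>F \<delta> in at_right 0.
        ennreal (c2 powr (- 1 / (1 + s)) * \<delta> powr (1 - s / (1 + s))) \<le> emeasure lebesgue (thickening (range u) \<delta>)
      \<and> emeasure lebesgue (thickening (range u) \<delta>) \<le> ennreal ((9 + 4 / (s * c1)) * \<delta> powr (1 - s / (1 + s)))"
    using eventually_conj[OF content_lower content_upper] by simp
qed (use s c1 c2 in auto)

end

section \<open>Orbits of slow relations near infinity\<close>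

lemma orbit_Suc [simp]: "orbit T y0 (Suc l) = T (orbit T y0 l)"
  by (simp add: orbit_def)

lemma orbit_0 [simp]: "orbit T y0 0 = y0"
  by (simp add: orbit_def)

text \<open>Passing from \<open>y\<close> to \<open>u = y\<^bsup>-\<kappa>\<^esup>\<close> turns the increments of order \<open>y\<^bsup>1-\<rho>\<^esup>\<close> into gaps of
  order \<open>y\<^bsup>-\<kappa>-\<rho>\<^esup> = u\<^bsup>1+\<rho>/\<kappa>\<^esup>\<close>.\<close>

lemma orbit_minkowski_dim:
  fixes T :: "real \<Rightarrow> real" and M \<rho> \<kappa> c1 c2 y0 :: real
  assumes M: "0 < M" and \<rho>: "0 < \<rho>" and \<kappa>: "0 < \<kappa>" and c: "0 < c1" "0 < c2"
    and lower: "\<And>y. M < y \<Longrightarrow> c1 * y powr (1 - \<rho>) \<le> T y - y"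
    and upper: "\<And>y. M < y \<Longrightarrow> T y - y \<le> c2 * y powr (1 - \<rho>)"
    and double: "\<And>y. M < y \<Longrightarrow> T y \<le> 2 * y"
    and y0: "M < y0"
  defines "u \<equiv> \<lambda>l. orbit T y0 l powr (- \<kappa>)"
  shows "filterlim (orbit T y0) at_top sequentially"
    and "minkowski_nondegenerate (range u)"
    and "has_minkowski_dim (range u) (\<rho> / (\<rho> + \<kappa>))"
proof -
  have incr: "y < T y" if "M < y" for y
  proof -
    have "0 < c1 * y powr (1 - \<rho>)"
      using c that M by simp
    then show ?thesis
      using lower[OF that] by linarith
  qed
  have gt: "M < orbit T y0 l" for l
    using y0 incr by (induction l) force+
  have gap: "c1 * \<kappa> * 2 powr (- \<kappa> - 1) * y powr (- \<kappa> - \<rho>) \<le> y powr (- \<kappa>) - T y powr (- \<kappa>)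
      \<and> y powr (- \<kappa>) - T y powr (- \<kappa>) \<le> c2 * \<kappa> * 2 powr (\<kappa> + \<rho>) * T y powr (- \<kappa> - \<rho>)" if "M < y" for y
  proof -
    have "0 < y"
      using that M by simp
    have "\<exists>z>y. z < T y \<and> T y powr (- \<kappa>) - y powr (- \<kappa>) = (T y - y) * (- \<kappa> * z powr (- \<kappa> - 1))"
      using incr[OF that] \<open>0 < y\<close>
      by (intro MVT2) (auto intro!: derivative_eq_intros simp: field_simps powr_diff)
    then obtain z where z: "y < z" "z < T y"
      and eq: "y powr (- \<kappa>) - T y powr (- \<kappa>) = (T y - y) * (\<kappa> * z powr (- \<kappa> - 1))"
      by (auto simp: algebra_simps)
    have "z < 2 * y"
      using z double[OF that] by linarith
    have pow: "y powr (- \<kappa> - \<rho>) = y powr (1 - \<rho>) * y powr (- \<kappa> - 1)"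
      by (simp add: powr_add[symmetric] algebra_simps)
    then have "c1 * \<kappa> * 2 powr (- \<kappa> - 1) * y powr (- \<kappa> - \<rho>)
        = (c1 * y powr (1 - \<rho>)) * (\<kappa> * (2 * y) powr (- \<kappa> - 1))"
      using \<open>0 < y\<close> by (simp add: powr_mult)
    also have "\<dots> \<le> (T y - y) * (\<kappa> * z powr (- \<kappa> - 1))"
      using lower[OF that] z \<open>z < 2 * y\<close> \<open>0 < y\<close> \<kappa> c by (intro mult_mono mult_left_mono powr_mono2') auto
    finally have 1: "c1 * \<kappa> * 2 powr (- \<kappa> - 1) * y powr (- \<kappa> - \<rho>) \<le> y powr (- \<kappa>) - T y powr (- \<kappa>)"
      using eq by simp
    have "(T y - y) * (\<kappa> * z powr (- \<kappa> - 1)) \<le> (c2 * y powr (1 - \<rho>)) * (\<kappa> * y powr (- \<kappa> - 1))"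
      using upper[OF that] z \<open>0 < y\<close> \<kappa> c by (intro mult_mono mult_left_mono powr_mono2') auto
    also have "\<dots> = c2 * \<kappa> * y powr (- \<kappa> - \<rho>)"
      unfolding pow by simp
    \<comment> \<open>The upper gap bound has to be stated at \<open>T y\<close>, the smaller end in
      the coordinate \<open>u\<close>; moving from \<open>y\<close> to \<open>T y\<close> costs only
      a constant factor because \<open>T y \<le> 2 * y\<close>.\<close>
    also have "\<dots> \<le> c2 * \<kappa> * (T y / 2) powr (- \<kappa> - \<rho>)"
      using double[OF that] z \<open>0 < y\<close> \<kappa> \<rho> c by (intro mult_left_mono powr_mono2') auto
    also have "(T y / 2) powr (- \<kappa> - \<rho>) = T y powr (- \<kappa> - \<rho>) * 2 powr (\<kappa> + \<rho>)"
      using z \<open>0 < y\<close> by (simp add: powr_divide powr_diff powr_add powr_minus divide_simps)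
    finally have "y powr (- \<kappa>) - T y powr (- \<kappa>) \<le> c2 * \<kappa> * 2 powr (\<kappa> + \<rho>) * T y powr (- \<kappa> - \<rho>)"
      using eq by (simp add: mult_ac)
    with 1 show ?thesis
      by blast
  qed
  have u_powr: "u l powr (1 + \<rho> / \<kappa>) = orbit T y0 l powr (- \<kappa> - \<rho>)" for l
    using \<kappa> by (simp add: u_def powr_powr algebra_simps)
  have sequence: "gap_sequence u (\<rho> / \<kappa>) (c1 * \<kappa> * 2 powr (- \<kappa> - 1)) (c2 * \<kappa> * 2 powr (\<kappa> + \<rho>))"
  proof
    show "0 < u k" for k
      using gt[of k] M by (simp add: u_def)
    show "c1 * \<kappa> * 2 powr (- \<kappa> - 1) * u k powr (1 + \<rho> / \<kappa>) \<le> u k - u (Suc k)" for k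
      using gap[OF gt[of k]] unfolding u_powr by (simp add: u_def)
    show "u k - u (Suc k) \<le> c2 * \<kappa> * 2 powr (\<kappa> + \<rho>) * u (Suc k) powr (1 + \<rho> / \<kappa>)" for k
      using gap[OF gt[of k]] unfolding u_powr by (simp add: u_def)
  qed (use \<rho> \<kappa> c in auto)
  have "\<rho> / \<kappa> / (1 + \<rho> / \<kappa>) = \<rho> / (\<rho> + \<kappa>)"
    using \<rho> \<kappa> by (simp add: field_simps)
  then show "minkowski_nondegenerate (range u)" "has_minkowski_dim (range u) (\<rho> / (\<rho> + \<kappa>))"
    using gap_sequence.minkowski_dim[OF sequence] by auto
  show "filterlim (orbit T y0) at_top sequentially"
    unfolding filterlim_at_top_gt[where c = 0]
  proof (intro allI impI)
    fix Z :: real assume "0 < Z"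
    then have "\<forall>\<^sub>F l in sequentially. u l < Z powr (- \<kappa>)"
      using order_tendstoD(2)[OF gap_sequence.tendsto_zero[OF sequence]] by simp
    then show "\<forall>\<^sub>F l in sequentially. Z \<le> orbit T y0 l"
    proof eventually_elim
      case (elim l)
      show ?case
      proof (rule ccontr)
        assume "\<not> Z \<le> orbit T y0 l"
        then have "Z powr (- \<kappa>) \<le> orbit T y0 l powr (- \<kappa>)"
          using gt[of l] M \<kappa> by (intro powr_mono2') auto
        then show False
          using elim by (simp add: u_def)
      qed
    qed
  qed
qed

text \<open>This replaces integrating \<open>- D'\<close> from \<open>y\<close> to infinity:
  subtracting the comparison function \<open>e / a * y powr (- a)\<close> from \<open>D\<close>
  gives a nondecreasing function with limit 0, which is therefore nonpositive.\<close>

lemma tail_le: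
  fixes D D' :: "real \<Rightarrow> real"
  assumes M: "0 < M" and a: "0 < a" and lim: "(D \<longlongrightarrow> 0) at_top"
    and deriv: "\<And>y. M \<le> y \<Longrightarrow> (D has_real_derivative D' y) (at y)"
    and bound: "\<And>y. M \<le> y \<Longrightarrow> - D' y \<le> e * y powr (- a - 1)"
    and y: "M \<le> y"
  shows "D y \<le> e / a * y powr (- a)"
proof -
  define H where "H y = D y - e / a * y powr (- a)" for y
  have H_mono: "H y \<le> H z" if "y \<le> z" for z
  proof (rule DERIV_nonneg_imp_nondecreasing[OF that])
    fix x assume x: "y \<le> x" "x \<le> z"
    have "(H has_real_derivative D' x + e * x powr (- a - 1)) (at x)"
      unfolding H_def using x y M a
      by (auto intro!: derivative_eq_intros deriv simp: powr_diff field_simps)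
    moreover have "0 \<le> D' x + e * x powr (- a - 1)"
      using bound[of x] x y by linarith
    ultimately show "\<exists>d. (H has_real_derivative d) (at x) \<and> 0 \<le> d"
      by blast
  qed
  have "\<forall>\<^sub>F z in at_top. H y \<le> H z"
    by (rule eventually_mono[OF eventually_ge_at_top[of y]]) (rule H_mono)
  moreover have "((\<lambda>y. y powr (- a)) \<longlongrightarrow> 0) at_top"
    using a by (intro tendsto_neg_powr filterlim_ident) auto
  then have "(H \<longlongrightarrow> 0 - e / a * 0) at_top"
    unfolding H_def by (intro tendsto_intros lim)
  ultimately have "H y \<le> 0"
    using tendsto_lowerbound by fastforce
  then show ?thesis
    by (simp add: H_def)
qed

lemma tail_ge:
  fixes D D' :: "real \<Rightarrow> real"
  assumes M: "0 < M" and a: "0 < a" and lim: "(D \<longlongrightarrow> 0) at_top"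
    and deriv: "\<And>y. M \<le> y \<Longrightarrow> (D has_real_derivative D' y) (at y)"
    and bound: "\<And>y. M \<le> y \<Longrightarrow> e * y powr (- a - 1) \<le> - D' y"
    and y: "M \<le> y"
  shows "e / a * y powr (- a) \<le> D y"
proof -
  have "- D y \<le> - e / a * y powr (- a)"
  proof (rule tail_le[OF M a, of _ "\<lambda>y. - D' y"])
    show "((\<lambda>y. - D y) \<longlongrightarrow> 0) at_top"
      using tendsto_minus[OF lim] by simp
    show "- (- D' y) \<le> - e * y powr (- a - 1)" if "M \<le> y" for y
      using bound[OF that] by simp
  qed (use y in \<open>auto intro: DERIV_minus deriv\<close>)
  then show ?thesis
    by simp
qed

text \<open>\<open>P\<close> and \<open>Q\<close> stand for \<open>I\<^sub>-\<close> and \<open>I\<^sub>+\<close> with \<open>T = S\<close>, or for \<open>I\<^sub>+\<close> and \<open>I\<^sub>-\<close> with \<open>T = S\<^sup>-\<^sup>1\<close>.\<close>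

locale slow_relation =
  fixes P Q P' Q' T :: "real \<Rightarrow> real" and \<gamma> \<rho> c k :: real
  assumes \<gamma>: "1 < \<gamma>" and \<rho>: "0 < \<rho>" and c: "0 < c" and k: "0 < k"
    and P_deriv: "\<And>y. 0 < y \<Longrightarrow> (P has_real_derivative P' y) (at y)"
    and Q_deriv: "\<And>y. 0 < y \<Longrightarrow> (Q has_real_derivative Q' y) (at y)"
    and Q_antimono: "\<And>x y. 0 \<le> x \<Longrightarrow> x < y \<Longrightarrow> Q y < Q x"
    and diff_lim: "((\<lambda>y. P y - Q y) \<longlongrightarrow> 0) at_top"
    and Q'_lim: "((\<lambda>y. Q' y * y powr \<gamma>) \<longlongrightarrow> - c) at_top"
    and diff'_lim: "((\<lambda>y. (P' y - Q' y) * y powr (\<gamma> + \<rho>)) \<longlongrightarrow> k) at_top"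
    and T_nonneg: "\<And>y. 0 \<le> y \<Longrightarrow> 0 \<le> T y"
    and T_eq: "\<And>y. 0 \<le> y \<Longrightarrow> P y = Q (T y)"
begin

lemma Q'_bounds:
  "\<forall>\<^sub>F y in at_top. c / 2 * y powr (- \<gamma>) \<le> - Q' y \<and> - Q' y \<le> 2 * c * y powr (- \<gamma>)"
proof -
  have "\<forall>\<^sub>F y in at_top. - 2 * c < Q' y * y powr \<gamma>" "\<forall>\<^sub>F y in at_top. Q' y * y powr \<gamma> < - c / 2"
    using order_tendstoD[OF Q'_lim] c by auto
  then show ?thesis
    using eventually_gt_at_top[of 0]
    by eventually_elim (auto simp: powr_minus field_simps)
qed

lemma diff_bounds:
  defines "a \<equiv> \<gamma> + \<rho> - 1"
  shows "\<forall>\<^sub>F y in at_top. k / 2 / a * y powr (- a) \<le> Q y - P y \<and> Q y - P y \<le> 2 * k / a * y powr (- a)"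
proof -
  have "\<forall>\<^sub>F y in at_top. k / 2 < (P' y - Q' y) * y powr (\<gamma> + \<rho>)"
    "\<forall>\<^sub>F y in at_top. (P' y - Q' y) * y powr (\<gamma> + \<rho>) < 2 * k"
    using order_tendstoD(1)[OF diff'_lim, of "k / 2"] order_tendstoD(2)[OF diff'_lim, of "2 * k"] k by auto
  then have "\<forall>\<^sub>F y in at_top. 0 < y \<and> k / 2 * y powr (- (\<gamma> + \<rho>)) \<le> P' y - Q' y \<and> P' y - Q' y \<le> 2 * k * y powr (- (\<gamma> + \<rho>))"
    using eventually_gt_at_top[of 0]
    by eventually_elim (simp only: powr_minus, simp add: field_simps)
  then obtain M where M: "\<And>y. M \<le> y \<Longrightarrow>
      0 < y \<and> k / 2 * y powr (- (\<gamma> + \<rho>)) \<le> P' y - Q' y \<and> P' y - Q' y \<le> 2 * k * y powr (- (\<gamma> + \<rho>))"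
    by (auto simp: eventually_at_top_linorder)
  have "0 < M" "0 < a"
    using M[of M] \<gamma> \<rho> by (auto simp: a_def)
  have lim: "((\<lambda>y. Q y - P y) \<longlongrightarrow> 0) at_top"
    using tendsto_minus[OF diff_lim] by simp
  have deriv: "((\<lambda>y. Q y - P y) has_real_derivative Q' y - P' y) (at y)" if "M \<le> y" for y
    using M[OF that] by (auto intro!: derivative_intros P_deriv Q_deriv)
  have exponent: "- a - 1 = - (\<gamma> + \<rho>)"
    by (simp add: a_def)
  show ?thesis
    using eventually_ge_at_top[of M]
  proof eventually_elim
    case (elim y)
    have "k / 2 / a * y powr (- a) \<le> Q y - P y"
      by (rule tail_ge[OF \<open>0 < M\<close> \<open>0 < a\<close> lim deriv]) (use M elim in \<open>auto simp: exponent\<close>)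
    moreover have "Q y - P y \<le> 2 * k / a * y powr (- a)"
      by (rule tail_le[OF \<open>0 < M\<close> \<open>0 < a\<close> lim deriv]) (use M elim in \<open>auto simp: exponent\<close>)
    ultimately show ?case
      by simp
  qed
qed

text \<open>The drop \<open>Q y - Q (T y) = Q y - P y\<close> has order
  \<open>y powr (1 - \<gamma> - \<rho>)\<close>. By the mean value theorem it is
  \<open>T y - y\<close> times a value of \<open>- Q'\<close>, which has order
  \<open>y powr (- \<gamma>)\<close> throughout \<open>[y, 2 * y]\<close>; the quotient has order
  \<open>y powr (1 - \<rho>)\<close>.\<close>

lemma increment_bounds:
  obtains M c1 c2 where "0 < M" "0 < c1" "0 < c2"
    "\<And>y. M < y \<Longrightarrow> c1 * y powr (1 - \<rho>) \<le> T y - y"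
    "\<And>y. M < y \<Longrightarrow> T y - y \<le> c2 * y powr (1 - \<rho>)"
    "\<And>y. M < y \<Longrightarrow> T y \<le> 2 * y"
proof -
  define a where "a = \<gamma> + \<rho> - 1"
  have a: "0 < a"
    using \<gamma> \<rho> by (simp add: a_def)
  have "((\<lambda>y. 2 * k / a * y powr (- \<rho>)) \<longlongrightarrow> 2 * k / a * 0) at_top"
    using \<rho> by (intro tendsto_intros tendsto_neg_powr filterlim_ident) auto
  moreover have "0 < c / 2 * 2 powr (- \<gamma>)"
    using c by simp
  \<comment> \<open>This choice of threshold will exclude \<open>T y > 2 * y\<close>: the drop of
    \<open>Q\<close> on \<open>[y, 2 * y]\<close> is at least
    \<open>c / 2 * 2 powr (- \<gamma>) * y powr (1 - \<gamma>)\<close>, while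
    \<open>Q y - P y\<close> is smaller by the decaying factor \<open>y powr (- \<rho>)\<close>, up
    to constants.\<close>
  ultimately have "\<forall>\<^sub>F y in at_top. 2 * k / a * y powr (- \<rho>) < c / 2 * 2 powr (- \<gamma>)"
    using order_tendstoD(2) by fastforce
  with Q'_bounds diff_bounds eventually_gt_at_top[of 0]
  have "\<forall>\<^sub>F y in at_top. 0 < y \<and> 2 * k / a * y powr (- \<rho>) < c / 2 * 2 powr (- \<gamma>)
      \<and> c / 2 * y powr (- \<gamma>) \<le> - Q' y \<and> - Q' y \<le> 2 * c * y powr (- \<gamma>)
      \<and> k / 2 / a * y powr (- a) \<le> Q y - P y \<and> Q y - P y \<le> 2 * k / a * y powr (- a)"
    by eventually_elim (auto simp: a_def)
  then obtain M where M: "\<And>y. M \<le> y \<Longrightarrow> 0 < y"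
    "\<And>y. M \<le> y \<Longrightarrow> 2 * k / a * y powr (- \<rho>) < c / 2 * 2 powr (- \<gamma>)"
    and Q'l: "\<And>y. M \<le> y \<Longrightarrow> c / 2 * y powr (- \<gamma>) \<le> - Q' y"
    and Q'u: "\<And>y. M \<le> y \<Longrightarrow> - Q' y \<le> 2 * c * y powr (- \<gamma>)"
    and Dl: "\<And>y. M \<le> y \<Longrightarrow> k / 2 / a * y powr (- a) \<le> Q y - P y"
    and Du: "\<And>y. M \<le> y \<Longrightarrow> Q y - P y \<le> 2 * k / a * y powr (- a)"
    by (auto simp: eventually_at_top_linorder)
  have increment: "y < T y \<and> T y \<le> 2 * y \<and>
      k / (4 * a * c) * y powr (1 - \<rho>) \<le> T y - y \<and> T y - y \<le> 4 * k * 2 powr \<gamma> / (a * c) * y powr (1 - \<rho>)"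
    if y: "M \<le> y" for y
  proof -
    have "0 < y"
      using M y by simp
    have mean: "\<exists>\<xi>>y. \<xi> < z \<and> Q y - Q z = (z - y) * (- Q' \<xi>)" if "y < z" for z
      using MVT2[OF that, of Q Q'] Q_deriv \<open>0 < y\<close> by (force simp: algebra_simps)
    have D: "Q y - Q (T y) = Q y - P y"
      using T_eq[of y] \<open>0 < y\<close> by simp
    have powr_a: "y powr (- a) = y powr (- \<gamma>) * y powr (1 - \<rho>)"
      by (simp add: a_def powr_add[symmetric] algebra_simps)
    have "0 < k / 2 / a * y powr (- a)"
      using k a \<open>0 < y\<close> by simp
    then have "Q (T y) < Q y"
      using Dl[OF y] D by linarith
    then have gt: "y < T y"
      using Q_antimono[of "T y" y] T_nonneg[of y] \<open>0 < y\<close> by (cases "T y" y rule: linorder_cases) auto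
    have le: "T y \<le> 2 * y"
    proof (rule ccontr)
      assume "\<not> T y \<le> 2 * y"
      then have "Q (T y) < Q (2 * y)"
        using \<open>0 < y\<close> by (intro Q_antimono) auto
      obtain \<xi> where \<xi>: "y < \<xi>" "\<xi> < 2 * y" "Q y - Q (2 * y) = y * (- Q' \<xi>)"
        using mean[of "2 * y"] \<open>0 < y\<close> by auto
      have "c / 2 * (2 * y) powr (- \<gamma>) \<le> c / 2 * \<xi> powr (- \<gamma>)"
        using \<xi> \<open>0 < y\<close> \<gamma> c by (intro mult_left_mono powr_mono2') auto
      also have "\<dots> \<le> - Q' \<xi>"
        using Q'l[of \<xi>] \<xi> y by simp
      finally have "y * (c / 2 * (2 * y) powr (- \<gamma>)) \<le> y * (- Q' \<xi>)"
        using \<open>0 < y\<close> by (intro mult_left_mono) auto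
      also have "\<dots> \<le> Q y - P y"
        using \<xi>(3) \<open>Q (T y) < Q (2 * y)\<close> D by simp
      also have "\<dots> \<le> 2 * k / a * y powr (- a)"
        by (rule Du[OF y])
      also have "y powr (- a) = y * y powr (- \<gamma>) * y powr (- \<rho>)"
        using \<open>0 < y\<close> powr_add[of y 1 "- \<gamma> - \<rho>"] powr_add[of y "- \<gamma>" "- \<rho>"] by (simp add: a_def algebra_simps)
      finally have "(c / 2 * 2 powr (- \<gamma>)) * (y * y powr (- \<gamma>)) \<le> (2 * k / a * y powr (- \<rho>)) * (y * y powr (- \<gamma>))"
        using \<open>0 < y\<close> by (simp add: powr_mult mult_ac)
      moreover have "0 < y * y powr (- \<gamma>)"
        using \<open>0 < y\<close> by simp
      ultimately show False
        using M(2)[OF y] by (simp only: mult_le_cancel_right_pos)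
    qed
    obtain \<xi> where \<xi>: "y < \<xi>" "\<xi> < T y" "Q y - P y = (T y - y) * (- Q' \<xi>)"
      using mean[OF gt] D by auto
    have "- Q' \<xi> \<le> 2 * c * \<xi> powr (- \<gamma>)"
      using Q'u[of \<xi>] \<xi> y by simp
    also have "\<dots> \<le> 2 * c * y powr (- \<gamma>)"
      using \<xi> \<open>0 < y\<close> \<gamma> c by (intro mult_left_mono powr_mono2') auto
    finally have "(T y - y) * (- Q' \<xi>) \<le> (T y - y) * (2 * c * y powr (- \<gamma>))"
      using gt by (intro mult_left_mono) auto
    then have "k / 2 / a * y powr (- a) \<le> (T y - y) * (2 * c * y powr (- \<gamma>))"
      using Dl[OF y] \<xi>(3) by linarith
    then have "(k / 2 / a * y powr (1 - \<rho>)) * y powr (- \<gamma>) \<le> ((T y - y) * (2 * c)) * y powr (- \<gamma>)"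
      unfolding powr_a by (simp add: algebra_simps)
    moreover have "0 < y powr (- \<gamma>)"
      using \<open>0 < y\<close> by simp
    ultimately have "k / 2 / a * y powr (1 - \<rho>) \<le> (T y - y) * (2 * c)"
      by (simp only: mult_le_cancel_right_pos)
    then have lower: "k / (4 * a * c) * y powr (1 - \<rho>) \<le> T y - y"
      using a c by (simp add: field_simps)
    have "c / 2 * (2 * y) powr (- \<gamma>) \<le> c / 2 * \<xi> powr (- \<gamma>)"
      using \<xi> le \<open>0 < y\<close> \<gamma> c by (intro mult_left_mono powr_mono2') auto
    also have "\<dots> \<le> - Q' \<xi>"
      using Q'l[of \<xi>] \<xi> y by simp
    finally have "(T y - y) * (c / 2 * (2 * y) powr (- \<gamma>)) \<le> (T y - y) * (- Q' \<xi>)"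
      using gt by (intro mult_left_mono) auto
    then have "(T y - y) * (c / 2 * (2 * y) powr (- \<gamma>)) \<le> 2 * k / a * y powr (- a)"
      using Du[OF y] \<xi>(3) by linarith
    then have "((T y - y) * (c / 2 * 2 powr (- \<gamma>))) * y powr (- \<gamma>) \<le> (2 * k / a * y powr (1 - \<rho>)) * y powr (- \<gamma>)"
      unfolding powr_a using \<open>0 < y\<close> by (simp add: powr_mult mult_ac)
    then have "(T y - y) * (c / 2 * 2 powr (- \<gamma>)) \<le> 2 * k / a * y powr (1 - \<rho>)"
      using \<open>0 < y powr (- \<gamma>)\<close> by (simp only: mult_le_cancel_right_pos)
    then have "T y - y \<le> 4 * k * 2 powr \<gamma> / (a * c) * y powr (1 - \<rho>)"
      using a c by (simp add: powr_minus field_simps)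
    with gt le lower show ?thesis
      by blast
  qed
  show ?thesis
    by (rule that[of M "k / (4 * a * c)" "4 * k * 2 powr \<gamma> / (a * c)"])
      (use increment M(1)[of M] a c k in auto)
qed

lemma large_orbits_have_dim:
  "large_orbits_have_dim m T (\<rho> / (\<rho> + 2 / (real m + 1)))"
proof -
  obtain M c1 c2 where M: "0 < M" "0 < c1" "0 < c2"
    "\<And>y. M < y \<Longrightarrow> c1 * y powr (1 - \<rho>) \<le> T y - y"
    "\<And>y. M < y \<Longrightarrow> T y - y \<le> c2 * y powr (1 - \<rho>)"
    "\<And>y. M < y \<Longrightarrow> T y \<le> 2 * y"
    using increment_bounds by blast
  have \<kappa>: "0 < 2 / (real m + 1)"
    by simp
  show ?thesis
    unfolding large_orbits_have_dim_def orbit_near_zero_def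
    using orbit_minkowski_dim[OF M(1) \<rho> \<kappa> M(2,3,4,5,6)] M(1) by (auto intro!: exI[of _ M])
qed

end

text \<open>Two functions with the same limit at infinity have the same range, so each value of one is
  attained by the other.\<close>

lemma relation_ex1:
  fixes P Q :: "real \<Rightarrow> real"
  assumes P_antimono: "\<And>x y. 0 \<le> x \<Longrightarrow> x < y \<Longrightarrow> P y < P x"
    and Q_antimono: "\<And>x y. 0 \<le> x \<Longrightarrow> x < y \<Longrightarrow> Q y < Q x"
    and cont: "continuous_on {0..} Q" and zero: "P 0 = Q 0"
    and lim: "((\<lambda>y. P y - Q y) \<longlongrightarrow> 0) at_top" and y: "0 \<le> y"
  shows "\<exists>!s. 0 \<le> s \<and> P y = Q s"
proof -
  \<comment> \<open>If \<open>Q\<close> stayed above \<open>P y\<close>, then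
    \<open>P s - Q s\<close> would remain below the negative number \<open>P (y + 1) - P y\<close>
    for all large \<open>s\<close>, contrary to the limit 0.\<close>
  have "\<exists>s\<ge>0. Q s \<le> P y"
  proof (rule ccontr)
    assume "\<not> (\<exists>s\<ge>0. Q s \<le> P y)"
    then have *: "P y < Q s" if "0 \<le> s" for s
      using that by force
    have "0 < P y - P (y + 1)"
      using P_antimono[of y "y + 1"] y by simp
    then have "\<forall>\<^sub>F s in at_top. - (P y - P (y + 1)) < P s - Q s"
      using order_tendstoD(1)[OF lim] by simp
    then have "\<forall>\<^sub>F s::real in at_top. False"
      using eventually_gt_at_top[of "y + 1"]
    proof eventually_elim
      case (elim s)
      then have "P s < P (y + 1)" "P y < Q s"
        using P_antimono[of "y + 1" s] *[of s] y by auto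
      with elim show ?case
        by linarith
    qed
    then show False
      by simp
  qed
  then obtain s0 where s0: "0 \<le> s0" "Q s0 \<le> P y"
    by blast
  have "P y \<le> Q 0"
    using P_antimono[of 0 y] zero y by (cases "y = 0") auto
  then have "\<exists>s\<ge>0. s \<le> s0 \<and> Q s = P y"
    using s0 by (intro IVT2' continuous_on_subset[OF cont]) auto
  then show ?thesis
    using Q_antimono by (metis less_irrefl linorder_neqE)
qed

section \<open>Slow divergence integrals\<close>

lemma poly_div_power_tendsto:
  fixes p :: "real poly"
  assumes "degree p \<le> d"
  shows "((\<lambda>x. poly p x / x ^ d) \<longlongrightarrow> coeff p d) at_top"
  using assms
proof (induction d arbitrary: p)
  case 0
  then show ?case
    by (auto elim: degree_eq_zeroE)
next
  case (Suc d)
  obtain a q where p: "p = pCons a q"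
    by (cases p) auto
  have "degree q \<le> d"
    using Suc.prems p by (cases "q = 0") auto
  then have "((\<lambda>x. a / x ^ Suc d + poly q x / x ^ d) \<longlongrightarrow> 0 + coeff q d) at_top"
    by (intro tendsto_intros Suc.IH tendsto_divide_0[OF tendsto_const] filterlim_at_top_imp_at_infinity
        filterlim_pow_at_top filterlim_ident) auto
  moreover have "\<forall>\<^sub>F x::real in at_top. a / x ^ Suc d + poly q x / x ^ d = poly p x / x ^ Suc d"
    using eventually_gt_at_top[of 0] by eventually_elim (simp add: p field_simps)
  ultimately show ?case
    by (simp add: p tendsto_cong)
qed

text \<open>Meant for sums and differences of a polynomial and its reflection, where the terms of
  high degree cancel and the surviving leading term lies \<open>r\<close> degrees lower.\<close>

lemma poly_shift_tendsto:
  fixes p :: "real poly"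
  assumes "\<And>k. d < k + r \<Longrightarrow> coeff p k = 0"
  shows "((\<lambda>x. x ^ r * poly p x / x ^ d) \<longlongrightarrow> (if d < r then 0 else coeff p (d - r))) at_top"
proof -
  have "degree (monom 1 r * p) \<le> d"
    using assms by (intro degree_le) (auto simp: coeff_monom_mult)
  from poly_div_power_tendsto[OF this] show ?thesis
    by (simp add: poly_monom coeff_monom_mult cong: if_cong)
qed

text \<open>Reflection turns the negative root into a positive one, so \<open>alpha\<close> can be
  handled as \<open>omega\<close> of the mirrored polynomial.\<close>

definition mirror :: "real poly \<Rightarrow> real poly" where
  "mirror p = p \<circ>\<^sub>p [:0, -1:]"

lemma poly_mirror [simp]: "poly (mirror p) x = poly p (- x)"
  by (simp add: mirror_def poly_pcompose)

lemma coeff_mirror [simp]: "coeff (mirror p) k = (- 1) ^ k * coeff p k"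
  by (simp add: mirror_def coeff_pcompose_linear)

lemma pderiv_mirror: "pderiv (mirror p) = - mirror (pderiv p)"
  by (simp add: mirror_def pderiv_pcompose pderiv_pCons)

section \<open>The inverse of an increasing polynomial on the nonnegative half-line\<close>

locale increasing_poly =
  fixes F :: "real poly"
  assumes at_0: "poly F 0 = 0"
    and pderiv_pos: "\<And>x. 0 < x \<Longrightarrow> 0 < poly (pderiv F) x"
    and at_top: "filterlim (poly F) at_top at_top"
begin

lemma poly_less: "0 \<le> x \<Longrightarrow> x < z \<Longrightarrow> poly F x < poly F z"
  by (rule DERIV_pos_imp_increasing_open) (auto intro!: exI poly_DERIV pderiv_pos continuous_intros)

lemma omega_poly: "0 \<le> x \<Longrightarrow> omega F (poly F x) = x"
proof (cases "x = 0")
  case False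
  assume "0 \<le> x"
  then have "0 < x" "poly F x \<noteq> 0"
    using False poly_less[of 0 x] at_0 by auto
  moreover have "(THE z. 0 < z \<and> poly F z = poly F x) = x"
    using \<open>0 < x\<close> by (intro the_equality) (auto, metis less_eq_real_def less_irrefl linorder_neqE poly_less)
  ultimately show ?thesis
    by (simp add: omega_def)
qed (simp add: at_0 omega_def)

lemma omega_exists:
  assumes "0 \<le> y" shows "\<exists>x\<ge>0. poly F x = y"
proof -
  obtain b where b: "0 \<le> b" "y \<le> poly F b"
    using eventually_happens[OF eventually_conj[OF eventually_ge_at_top[of 0]
          filterlim_at_top[THEN iffD1, OF at_top, rule_format, of y]]] by auto
  have "\<exists>x\<ge>0. x \<le> b \<and> poly F x = y"
    using assms b at_0 by (intro IVT') (auto intro!: continuous_intros)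
  then show ?thesis
    by blast
qed

lemma poly_omega: "0 \<le> y \<Longrightarrow> poly F (omega F y) = y" and omega_nonneg: "0 \<le> y \<Longrightarrow> 0 \<le> omega F y"
  using omega_exists omega_poly by metis+

lemma omega_0 [simp]: "omega F 0 = 0"
  by (simp add: omega_def)

lemma omega_less: "0 \<le> x \<Longrightarrow> x < y \<Longrightarrow> omega F x < omega F y"
  using poly_less[of "omega F y" "omega F x"] poly_omega[of x] poly_omega[of y] omega_nonneg[of y]
  by (cases "omega F x" "omega F y" rule: linorder_cases) auto

lemma omega_pos: "0 < y \<Longrightarrow> 0 < omega F y"
  using omega_less[of 0 y] by simp

lemma omega_at_top: "filterlim (omega F) at_top at_top"
  unfolding filterlim_at_top_gt[where c = 0]
proof (intro allI impI)
  fix Z :: real assume "0 < Z"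
  show "\<forall>\<^sub>F y in at_top. Z \<le> omega F y"
    using eventually_gt_at_top[of "poly F Z"]
  proof eventually_elim
    case (elim y)
    then show ?case
      using omega_less[of "poly F Z" y] omega_poly[of Z] poly_less[of 0 Z] \<open>0 < Z\<close> at_0 by simp
  qed
qed

lemma continuous_on_omega: "continuous_on {0..} (omega F)"
proof -
  have "continuous (at y within {0..}) (omega F)" if "0 \<le> y" for y
  proof -
    \<comment> \<open>\<open>poly F\<close> maps the compact interval \<open>[0, b]\<close>
      injectively onto \<open>[0, y + 1]\<close>, a neighbourhood of \<open>y\<close> in the
      half-line, so its inverse is continuous there.\<close>
    define b where "b = omega F (y + 1)"
    have "poly F ` {0..b} = {0..y + 1}"
    proof
      show "poly F ` {0..b} \<subseteq> {0..y + 1}"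
        using poly_less at_0 poly_omega[of "y + 1"] that by (force simp: b_def less_eq_real_def)
      show "{0..y + 1} \<subseteq> poly F ` {0..b}"
      proof
        fix z assume "z \<in> {0..y + 1}"
        then show "z \<in> poly F ` {0..b}"
          using poly_omega[of z] omega_nonneg[of z] omega_less[of z "y + 1"]
          by (intro image_eqI[of _ _ "omega F z"]) (auto simp: b_def less_eq_real_def)
      qed
    qed
    moreover have "continuous_on (poly F ` {0..b}) (omega F)"
      by (rule continuous_on_inv) (auto intro!: continuous_intros omega_poly)
    ultimately have "continuous (at y within {0..y + 1}) (omega F)"
      using that by (simp add: continuous_on_eq_continuous_within)
    moreover have "at y within {0..} = at y within {0..y + 1}"
      by (rule at_within_nhd[of _ "{y - 1<..<y + 1}"]) auto
    ultimately show ?thesis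
      by simp
  qed
  then show ?thesis
    by (simp add: continuous_on_eq_continuous_within)
qed

lemma omega_has_derivative:
  assumes "0 < y"
  shows "(omega F has_real_derivative inverse (poly (pderiv F) (omega F y))) (at y)"
proof (rule DERIV_inverse_function[OF poly_DERIV, of _ _ _ 0 "y + 1"])
  show "poly (pderiv F) (omega F y) \<noteq> 0"
    using pderiv_pos[OF omega_pos[OF assms]] by simp
  show "isCont (omega F) y"
    using continuous_on_interior[OF continuous_on_omega] assms by simp
qed (use assms poly_omega in auto)

end

section \<open>The slow divergence integrals as functions of \<open>y\<close>\<close>

locale lienard =
  fixes F G f g :: "real poly"
  assumes F_0: "poly F 0 = 0"
    and F_factor: "pderiv F = [:0, 1:] * f" and G_factor: "G = [:0, 1:] * g"
    and f_pos: "\<And>x. 0 < poly f x" and g_neg: "\<And>x. poly g x < 0"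
    and F_at_top: "filterlim (poly F) at_top at_top"
    and mirror_at_top: "filterlim (poly (mirror F)) at_top at_top"
begin

sublocale right: increasing_poly F
  by standard (use F_0 F_factor f_pos F_at_top in auto)

sublocale left: increasing_poly "mirror F"
proof
  show "0 < poly (pderiv (mirror F)) x" if "0 < x" for x
    using that f_pos[of "- x"] by (simp add: pderiv_mirror F_factor)
qed (use F_0 mirror_at_top in auto)

lemma alpha: "0 \<le> y \<Longrightarrow> alpha F y = - omega (mirror F) y"
proof (cases "y = 0")
  case False
  assume "0 \<le> y"
  then have y: "0 < y"
    using False by simp
  have "(THE x. x < 0 \<and> poly F x = y) = - omega (mirror F) y"
  proof (rule the_equality)
    show "x = - omega (mirror F) y" if "x < 0 \<and> poly F x = y" for x
      using left.omega_poly[of "- x"] that by auto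
  qed (use left.omega_pos[OF y] left.poly_omega[of y] y in auto)
  then show ?thesis
    using y by (simp add: alpha_def)
qed (simp add: alpha_def)

text \<open>A single primitive on the whole line expresses both integrals for all \<open>y\<close>;
  lemma \<open>antiderivative\<close> justifies the choice.\<close>

definition antiderivative :: "real \<Rightarrow> real" where
  "antiderivative = (SOME \<Phi>. \<forall>x. (\<Phi> has_real_derivative (poly (pderiv F) x)\<^sup>2 / poly G x) (at x))"

lemma integrand: "(poly (pderiv F) x)\<^sup>2 / poly G x = x * (poly f x)\<^sup>2 / poly g x"
  by (simp add: F_factor G_factor power2_eq_square)

text \<open>The simple zero of \<open>G\<close> at 0 cancels against the double zero of the
  numerator, and the remaining denominator \<open>g\<close> never vanishes.\<close>

lemma integrand_cont: "continuous_on S (\<lambda>x. (poly (pderiv F) x)\<^sup>2 / poly G x)"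
  unfolding integrand using g_neg by (intro continuous_intros) (auto simp: less_imp_neq)

lemma antiderivative: "(antiderivative has_real_derivative (poly (pderiv F) x)\<^sup>2 / poly G x) (at x)"
proof -
  have "isCont (\<lambda>x. (poly (pderiv F) x)\<^sup>2 / poly G x) x" for x
    using integrand_cont[of UNIV] by (simp add: continuous_on_eq_continuous_at)
  then have "\<exists>\<Phi>. \<forall>x. (\<Phi> has_real_derivative (poly (pderiv F) x)\<^sup>2 / poly G x) (at x)"
    using einterval_antiderivative[of "- \<infinity>" \<infinity> "\<lambda>x. (poly (pderiv F) x)\<^sup>2 / poly G x"]
    by (simp add: has_real_derivative_iff_has_vector_derivative)
  from someI_ex[OF this] show ?thesis
    by (simp add: antiderivative_def)
qed

lemma integral: "(LBINT x = a..0. (poly (pderiv F) x)\<^sup>2 / poly G x) = antiderivative 0 - antiderivative a"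
  using interval_integral_FTC_finite[OF integrand_cont, of a 0 antiderivative]
    antiderivative[THEN has_vector_derivative_at_within[OF has_real_derivative_iff_has_vector_derivative[THEN iffD1]]]
  by (simp add: zero_ereal_def)

lemma I_minus: "I_minus F G y = antiderivative (omega F y) - antiderivative 0"
  by (simp add: I_minus_def integral)

lemma I_plus: "0 \<le> y \<Longrightarrow> I_plus F G y = antiderivative (- omega (mirror F) y) - antiderivative 0"
  by (simp add: I_plus_def integral alpha)

lemma I_minus_0: "I_minus F G 0 = 0" and I_plus_0: "I_plus F G 0 = 0"
  by (simp_all add: I_minus I_plus)

lemma antiderivative_less_right:
  assumes "0 \<le> x" "x < z" shows "antiderivative z < antiderivative x"
proof (rule DERIV_neg_imp_decreasing_open[where f = antiderivative])
  fix t assume "x < t"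
  then have "(poly (pderiv F) t)\<^sup>2 / poly G t < 0"
    unfolding integrand using assms f_pos[of t] g_neg[of t] by (intro divide_pos_neg) auto
  then show "\<exists>d. (antiderivative has_real_derivative d) (at t) \<and> d < 0"
    using antiderivative by blast
next
  show "continuous_on {x..z} antiderivative"
    using antiderivative by (intro DERIV_continuous_on) (blast intro: has_field_derivative_at_within)
qed (use assms in auto)

lemma antiderivative_less_left:
  assumes "x < z" "z \<le> 0" shows "antiderivative x < antiderivative z"
proof (rule DERIV_pos_imp_increasing_open[where f = antiderivative])
  fix t assume "t < z"
  then have "0 < (poly (pderiv F) t)\<^sup>2 / poly G t"
    unfolding integrand using assms f_pos[of t] g_neg[of t] by (intro divide_neg_neg mult_neg_pos) auto
  then show "\<exists>d. (antiderivative has_real_derivative d) (at t) \<and> 0 < d"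
    using antiderivative by blast
next
  show "continuous_on {x..z} antiderivative"
    using antiderivative by (intro DERIV_continuous_on) (blast intro: has_field_derivative_at_within)
qed (use assms in auto)

lemma I_minus_antimono: "0 \<le> x \<Longrightarrow> x < y \<Longrightarrow> I_minus F G y < I_minus F G x"
  using right.omega_less[of x y] right.omega_nonneg[of x] antiderivative_less_right by (simp add: I_minus)

lemma I_plus_antimono: "0 \<le> x \<Longrightarrow> x < y \<Longrightarrow> I_plus F G y < I_plus F G x"
  using left.omega_less[of x y] left.omega_nonneg[of x] antiderivative_less_left by (simp add: I_plus)

lemma continuous_on_I_minus: "continuous_on {0..} (I_minus F G)"
proof -
  have "continuous_on UNIV antiderivative"
    using antiderivative by (intro DERIV_continuous_on)
  from continuous_on_compose2[OF this right.continuous_on_omega] show ?thesis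
    unfolding I_minus by (intro continuous_intros) auto
qed

lemma continuous_on_I_plus: "continuous_on {0..} (I_plus F G)"
proof -
  have "continuous_on UNIV antiderivative"
    using antiderivative by (intro DERIV_continuous_on)
  from continuous_on_compose2[OF this continuous_on_minus[OF left.continuous_on_omega]]
  have "continuous_on {0..} (\<lambda>y. antiderivative (- omega (mirror F) y) - antiderivative 0)"
    by (intro continuous_intros) auto
  then show ?thesis
    by (rule continuous_on_eq) (simp add: I_plus)
qed

lemma I_minus_deriv:
  assumes "0 < y"
  shows "(I_minus F G has_real_derivative poly (pderiv F) (omega F y) / poly G (omega F y)) (at y)"
proof -
  have "0 < poly (pderiv F) (omega F y)"
    using right.pderiv_pos[OF right.omega_pos[OF assms]] .
  then show ?thesis
    using DERIV_chain2[OF antiderivative right.omega_has_derivative[OF assms]]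
    unfolding I_minus[abs_def] by (auto intro!: derivative_eq_intros simp: field_simps power2_eq_square)
qed

lemma I_plus_deriv:
  assumes "0 < y"
  defines "x \<equiv> - omega (mirror F) y"
  shows "(I_plus F G has_real_derivative poly (pderiv F) x / poly G x) (at y)"
proof -
  have "x < 0"
    using left.omega_pos[OF assms(1)] by (simp add: x_def)
  then have "poly (pderiv F) x < 0"
    using f_pos[of x] by (simp add: F_factor mult_neg_pos)
  moreover have "((\<lambda>y. - omega (mirror F) y) has_real_derivative inverse (poly (pderiv F) x)) (at y)"
    using DERIV_minus[OF left.omega_has_derivative[OF assms(1)]]
    by (simp add: x_def pderiv_mirror inverse_minus_eq)
  ultimately have "((\<lambda>y. antiderivative (- omega (mirror F) y) - antiderivative 0)
      has_real_derivative poly (pderiv F) x / poly G x) (at y)"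
    using DERIV_chain2[OF antiderivative, of "\<lambda>y. - omega (mirror F) y"]
    by (auto intro!: derivative_eq_intros simp: field_simps power2_eq_square x_def)
  \<comment> \<open>The formula for \<open>I_plus\<close> holds only for nonnegative arguments, so
    the derivative is transferred on the open half-line around \<open>y\<close>.\<close>
  then show ?thesis
    by (rule has_field_derivative_transform_within_open[of _ _ _ "{0<..}"]) (use assms I_plus in auto)
qed

lemma slow_rel_ex1:
  assumes "(slow_div_integral F G \<longlongrightarrow> 0) at_top" and "0 \<le> y"
  shows "\<exists>!s. 0 \<le> s \<and> I_minus F G y = I_plus F G s" and "\<exists>!s. 0 \<le> s \<and> I_plus F G y = I_minus F G s"
proof -
  have lim: "((\<lambda>y. I_minus F G y - I_plus F G y) \<longlongrightarrow> 0) at_top"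
    using assms(1) by (simp add: slow_div_integral_def[abs_def])
  show "\<exists>!s. 0 \<le> s \<and> I_minus F G y = I_plus F G s"
    by (rule relation_ex1) (use I_minus_antimono I_plus_antimono continuous_on_I_plus I_minus_0 I_plus_0 lim assms in auto)
  show "\<exists>!s. 0 \<le> s \<and> I_plus F G y = I_minus F G s"
    by (rule relation_ex1) (use I_minus_antimono I_plus_antimono continuous_on_I_minus I_minus_0 I_plus_0
        tendsto_minus[OF lim] assms in auto)
qed

lemma slow_rel:
  assumes "(slow_div_integral F G \<longlongrightarrow> 0) at_top" and "0 \<le> y"
  shows "0 \<le> slow_rel F G y" and "I_minus F G y = I_plus F G (slow_rel F G y)"
  using theI'[OF slow_rel_ex1(1)[OF assms]] by (auto simp: slow_rel_def)

lemma slow_rel_inv: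
  assumes lim: "(slow_div_integral F G \<longlongrightarrow> 0) at_top" and "0 \<le> y"
  shows "0 \<le> slow_rel_inv F G y" and "I_plus F G y = I_minus F G (slow_rel_inv F G y)"
proof -
  \<comment> \<open>\<open>inv_into\<close> is a right inverse only on the range of
    \<open>slow_rel\<close>. Solvability with the roles of the integrals exchanged supplies a
    preimage of every \<open>y \<ge> 0\<close>.\<close>
  obtain s where s: "0 \<le> s" "I_plus F G y = I_minus F G s"
    using slow_rel_ex1(2)[OF assms] by blast
  then have "slow_rel F G s = y"
    using slow_rel_ex1(1)[OF lim s(1)] slow_rel[OF lim s(1)] \<open>0 \<le> y\<close> by metis
  then have y: "y \<in> slow_rel F G ` {0..}"
    using s by auto
  show nonneg: "0 \<le> slow_rel_inv F G y"
    using inv_into_into[OF y] by (simp add: slow_rel_inv_def)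
  show "I_plus F G y = I_minus F G (slow_rel_inv F G y)"
    using slow_rel(2)[OF lim nonneg] f_inv_into_f[OF y] by (simp add: slow_rel_inv_def)
qed

end

section \<open>Asymptotics of the slow divergence integrals\<close>

lemma mean_value_point_tendsto:
  fixes f f' z :: "real \<Rightarrow> real"
  assumes deriv: "\<And>x. 0 < x \<Longrightarrow> (f has_real_derivative f' x) (at x)"
    and z: "filterlim z at_top at_top" and ratio: "((\<lambda>x. z x / x) \<longlongrightarrow> 1) at_top"
  obtains \<xi> where "filterlim \<xi> at_top at_top" "((\<lambda>x. \<xi> x / x) \<longlongrightarrow> 1) at_top"
    "\<forall>\<^sub>F x in at_top. f (z x) - f x = (z x - x) * f' (\<xi> x)"
proof -
  have "\<exists>\<xi>. min x w \<le> \<xi> \<and> \<xi> \<le> max x w \<and> f w - f x = (w - x) * f' \<xi>" if "0 < x" "0 < w" for x w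
  proof (cases x w rule: linorder_cases)
    case less
    have "\<exists>\<xi>>x. \<xi> < w \<and> f w - f x = (w - x) * f' \<xi>"
      by (rule MVT2[OF less]) (use deriv that in auto)
    then show ?thesis
      using less by (metis less_imp_le max.absorb2 min.absorb1)
  next
    case greater
    have "\<exists>\<xi>>w. \<xi> < x \<and> f x - f w = (x - w) * f' \<xi>"
      by (rule MVT2[OF greater]) (use deriv that in auto)
    then obtain \<xi> where "w < \<xi>" "\<xi> < x" "f x - f w = (x - w) * f' \<xi>"
      by blast
    then show ?thesis
      by (intro exI[of _ \<xi>]) (auto simp: algebra_simps)
  qed auto
  then obtain p where p: "\<And>x w. 0 < x \<Longrightarrow> 0 < w \<Longrightarrow>
      min x w \<le> p x w \<and> p x w \<le> max x w \<and> f w - f x = (w - x) * f' (p x w)"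
    by metis
  define \<xi> where "\<xi> x = p x (z x)" for x
  have ev: "\<forall>\<^sub>F x in at_top. 0 < x \<and> min x (z x) \<le> \<xi> x \<and> \<xi> x \<le> max x (z x)
      \<and> f (z x) - f x = (z x - x) * f' (\<xi> x)"
    using eventually_gt_at_top[of 0] filterlim_at_top_dense[THEN iffD1, OF z, rule_format, of 0]
    unfolding \<xi>_def by eventually_elim (use p in simp)
  show ?thesis
  proof
    have bounds: "\<forall>\<^sub>F x in at_top. min 1 (z x / x) \<le> \<xi> x / x" "\<forall>\<^sub>F x in at_top. \<xi> x / x \<le> max 1 (z x / x)"
      using ev by (eventually_elim, simp add: min_def max_def divide_simps split: if_splits)+
    have "((\<lambda>x. min 1 (z x / x)) \<longlongrightarrow> 1) at_top" "((\<lambda>x. max 1 (z x / x)) \<longlongrightarrow> 1) at_top"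
      using tendsto_min[OF tendsto_const ratio, of 1] tendsto_max[OF tendsto_const ratio, of 1] by simp_all
    from tendsto_sandwich[OF bounds this] show lim: "((\<lambda>x. \<xi> x / x) \<longlongrightarrow> 1) at_top" .
    have "filterlim (\<lambda>x. \<xi> x / x * x) at_top at_top"
      by (rule filterlim_tendsto_pos_mult_at_top[OF lim _ filterlim_ident]) simp
    then show "filterlim \<xi> at_top at_top"
      by (rule filterlim_mono_eventually[OF _ order_refl order_refl])
        (rule eventually_mono[OF eventually_gt_at_top[of 0]], simp)
    show "\<forall>\<^sub>F x in at_top. f (z x) - f x = (z x - x) * f' (\<xi> x)"
      using ev by eventually_elim simp
  qed
qed

text \<open>To be read with \<open>a, a'\<close> and \<open>b, b'\<close> the values of
  \<open>F'\<close> and \<open>G\<close> at \<open>x\<close> and \<open>- x\<close>, and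
  \<open>N, M, R\<close> the powers \<open>n, m, r\<close> of \<open>x\<close>. It expresses
  \<open>h x - h (- x)\<close> through the sums \<open>a + a'\<close> and \<open>b + b'\<close>, in
  which the leading terms cancel.\<close>

lemma quotient_asymmetry:
  fixes a a' b b' :: real
  assumes "M \<noteq> 0" "b \<noteq> 0" "b' \<noteq> 0"
  shows "((a / N) * (R * (b + b') / M) - (R * (a + a') / N) * (b / M)) / ((b / M) * (b' / M))
    = (a / b - a' / b') * (M * R / N)"
proof -
  have "(a / N) * (R * (b + b') / M) - (R * (a + a') / N) * (b / M) = (a * b' - a' * b) * (R / (N * M))"
    by (simp add: algebra_simps add_divide_distrib diff_divide_distrib)
  moreover have "a / b - a' / b' = (a * b' - a' * b) / (b * b')"
    using assms by (simp add: diff_frac_eq mult.commute)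
  ultimately show ?thesis
    using assms by (simp add: mult.commute mult.left_commute)
qed

lemma quotient_rule_scaled:
  fixes a a' b b' x :: real
  assumes "x \<noteq> 0" "N \<noteq> 0" "M \<noteq> 0" "b \<noteq> 0"
  shows "((a' / N) * (b / (x * M)) - (a / (x * N)) * (b' / M)) / (b / (x * M))\<^sup>2
    = (a' * b - a * b') / b\<^sup>2 * (x * M / N)"
proof -
  have "(a' / N) * (b / (x * M)) - (a / (x * N)) * (b' / M) = (a' * b - a * b') / (x * N * M)"
    by (simp add: algebra_simps diff_divide_distrib)
  then show ?thesis
    using assms by (simp add: power2_eq_square)
qed

text \<open>The coefficients \<open>\<beta>\<close> and \<open>- e\<close> of \<open>F\<close> and \<open>G\<close> lie \<open>r\<close> degrees below the leading ones
  and are the first ones that break the symmetry \<open>x \<mapsto> - x\<close>; one of them may be 0.\<close>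

locale lienard_asymptotics = lienard +
  fixes n m r :: nat and \<beta> e :: real
  assumes n: "odd n" and m: "odd m" and r: "odd r" and m_gt: "2 * n + 1 < m"
    and F_high: "\<And>k. n + 1 < k \<Longrightarrow> coeff F k = 0" and F_lead: "coeff F (n + 1) = 1"
    and G_high: "\<And>k. m < k \<Longrightarrow> coeff G k = 0" and G_lead: "coeff G m = - 1"
    and F_odd: "\<And>k. odd k \<Longrightarrow> n + 1 < k + r \<Longrightarrow> coeff F k = 0"
    and G_even: "\<And>k. even k \<Longrightarrow> m < k + r \<Longrightarrow> coeff G k = 0"
    and \<beta>: "\<beta> = (if n + 1 < r then 0 else coeff F (n + 1 - r))"
    and e: "e = - (if m < r then 0 else coeff G (m - r))"
begin

lemma degree_F: "degree F \<le> n + 1" and degree_G: "degree G \<le> m"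
  using F_high G_high by (auto intro: degree_le)

lemma lim_F: "((\<lambda>x. poly F x / x ^ (n + 1)) \<longlongrightarrow> 1) at_top"
  using poly_div_power_tendsto[OF degree_F] F_lead by simp

lemma lim_mirror_F: "((\<lambda>x. poly (mirror F) x / x ^ (n + 1)) \<longlongrightarrow> 1) at_top"
  using poly_div_power_tendsto[of "mirror F" "n + 1"] F_high F_lead n by (simp add: degree_le)

lemma lim_F': "((\<lambda>x. poly (pderiv F) x / x ^ n) \<longlongrightarrow> real n + 1) at_top"
  using poly_div_power_tendsto[of "pderiv F" n] F_high F_lead by (simp add: degree_le coeff_pderiv add.commute)

lemma lim_mirror_F': "((\<lambda>x. poly (mirror (pderiv F)) x / x ^ n) \<longlongrightarrow> - (real n + 1)) at_top"
  using poly_div_power_tendsto[of "mirror (pderiv F)" n] F_high F_lead n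
  by (simp add: degree_le coeff_pderiv add.commute)

lemma lim_mirror_F'': "((\<lambda>x. poly (pderiv (mirror (pderiv F))) x / x ^ (n - 1)) \<longlongrightarrow> - ((real n + 1) * real n)) at_top"
proof -
  have "n = Suc (n - 1)"
    using n by (cases n) auto
  then show ?thesis
    using poly_div_power_tendsto[of "pderiv (mirror (pderiv F))" "n - 1"] F_high F_lead n
    by (simp add: degree_le coeff_pderiv algebra_simps)
qed

lemma lim_G: "((\<lambda>x. poly G x / x ^ m) \<longlongrightarrow> - 1) at_top"
  using poly_div_power_tendsto[OF degree_G] G_lead by simp

lemma lim_mirror_G: "((\<lambda>x. poly (mirror G) x / x ^ m) \<longlongrightarrow> 1) at_top"
  using poly_div_power_tendsto[of "mirror G" m] G_high G_lead m by (simp add: degree_le)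

lemma lim_mirror_G': "((\<lambda>x. poly (pderiv (mirror G)) x / x ^ (m - 1)) \<longlongrightarrow> real m) at_top"
proof -
  have "m = Suc (m - 1)"
    using m by (cases m) auto
  then show ?thesis
    using poly_div_power_tendsto[of "pderiv (mirror G)" "m - 1"] G_high G_lead m
    by (simp add: degree_le coeff_pderiv)
qed

text \<open>The difference is twice the odd part of \<open>F\<close>, whose terms have degree at
  most \<open>n + 1 - r\<close>.\<close>

lemma lim_F_odd: "((\<lambda>x. x ^ r * (poly F x - poly (mirror F) x) / x ^ (n + 1)) \<longlongrightarrow> 2 * \<beta>) at_top"
  using poly_shift_tendsto[of "n + 1" r "F - mirror F"] F_odd n r
  by (auto simp: \<beta> minus_one_power_iff split: if_splits)

lemma lim_F'_even:
  "((\<lambda>x. x ^ r * (poly (pderiv F) x + poly (mirror (pderiv F)) x) / x ^ n) \<longlongrightarrow> 2 * (real n + 1 - real r) * \<beta>) at_top"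
proof -
  have "coeff (pderiv F + mirror (pderiv F)) k = 0" if "n < k + r" for k
    using F_odd[of "Suc k"] that by (cases "even k") (auto simp: coeff_pderiv)
  moreover have "(if n < r then 0 else coeff (pderiv F + mirror (pderiv F)) (n - r)) = 2 * (real n + 1 - real r) * \<beta>"
    using n r by (auto simp: \<beta> coeff_pderiv Suc_diff_le of_nat_diff elim!: oddE)
  ultimately show ?thesis
    using poly_shift_tendsto[of n r "pderiv F + mirror (pderiv F)"] by (simp del: poly_mirror)
qed

lemma lim_G_even: "((\<lambda>x. x ^ r * (poly G x + poly (mirror G) x) / x ^ m) \<longlongrightarrow> - 2 * e) at_top"
  using poly_shift_tendsto[of m r "G + mirror G"] G_even m r
  by (auto simp: e minus_one_power_iff split: if_splits)

section \<open>The quotient \<open>h = F' / G\<close> near both infinities\<close>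

definition h :: "real \<Rightarrow> real" where
  "h x = poly (pderiv F) x / poly G x"

lemma G_neg: "0 < x \<Longrightarrow> poly G x < 0" and mirror_G_pos: "0 < x \<Longrightarrow> 0 < poly (mirror G) x"
  using g_neg[of x] g_neg[of "- x"] by (simp_all add: G_factor mult_pos_neg mult_neg_neg)

lemma lim_h: "((\<lambda>x. h x * x ^ (m - n)) \<longlongrightarrow> - (real n + 1)) at_top"
proof -
  have "((\<lambda>x. (poly (pderiv F) x / x ^ n) / (poly G x / x ^ m)) \<longlongrightarrow> (real n + 1) / (- 1)) at_top"
    by (intro tendsto_intros lim_F' lim_G) auto
  moreover have "\<forall>\<^sub>F x in at_top. (poly (pderiv F) x / x ^ n) / (poly G x / x ^ m) = h x * x ^ (m - n)"
    using eventually_gt_at_top[of 0]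
    by eventually_elim (use m_gt in \<open>simp add: h_def power_diff field_simps\<close>)
  ultimately show ?thesis
    by (simp add: tendsto_cong)
qed

lemma lim_mirror_h: "((\<lambda>x. h (- x) * x ^ (m - n)) \<longlongrightarrow> - (real n + 1)) at_top"
proof -
  have "((\<lambda>x. (poly (mirror (pderiv F)) x / x ^ n) / (poly (mirror G) x / x ^ m)) \<longlongrightarrow> - (real n + 1) / 1) at_top"
    by (intro tendsto_intros lim_mirror_F' lim_mirror_G) auto
  moreover have "\<forall>\<^sub>F x in at_top. (poly (mirror (pderiv F)) x / x ^ n) / (poly (mirror G) x / x ^ m) = h (- x) * x ^ (m - n)"
    using eventually_gt_at_top[of 0]
    by eventually_elim (use m_gt in \<open>simp add: h_def power_diff field_simps\<close>)
  ultimately show ?thesis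
    by (simp add: tendsto_cong)
qed

lemma lim_h_diff: "((\<lambda>x. (h x - h (- x)) * x ^ (m - n + r)) \<longlongrightarrow> 2 * (real n + 1) * e - 2 * (real n + 1 - real r) * \<beta>) at_top"
proof -
  let ?S1 = "\<lambda>x. x ^ r * (poly (pderiv F) x + poly (mirror (pderiv F)) x) / x ^ n"
  let ?S2 = "\<lambda>x. x ^ r * (poly G x + poly (mirror G) x) / x ^ m"
  have "((\<lambda>x. ((poly (pderiv F) x / x ^ n) * ?S2 x - ?S1 x * (poly G x / x ^ m)) / ((poly G x / x ^ m) * (poly (mirror G) x / x ^ m)))
      \<longlongrightarrow> ((real n + 1) * (- 2 * e) - 2 * (real n + 1 - real r) * \<beta> * (- 1)) / ((- 1) * 1)) at_top"
    by (intro tendsto_intros lim_F' lim_G lim_mirror_G lim_F'_even lim_G_even) auto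
  moreover have "\<forall>\<^sub>F x in at_top. ((poly (pderiv F) x / x ^ n) * ?S2 x - ?S1 x * (poly G x / x ^ m))
      / ((poly G x / x ^ m) * (poly (mirror G) x / x ^ m)) = (h x - h (- x)) * x ^ (m - n + r)"
    using eventually_gt_at_top[of 0]
  proof eventually_elim
    case (elim x)
    have "poly G x \<noteq> 0" "poly G (- x) \<noteq> 0"
      using G_neg[OF elim] mirror_G_pos[OF elim] by auto
    moreover have pow: "x ^ (m - n + r) = x ^ m * x ^ r / x ^ n"
      using elim m_gt by (simp add: power_add power_diff)
    moreover have "x ^ m \<noteq> 0"
      using elim by auto
    ultimately show ?case
      unfolding pow h_def poly_mirror by (intro quotient_asymmetry)
  qed
  ultimately have "((\<lambda>x. (h x - h (- x)) * x ^ (m - n + r))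
      \<longlongrightarrow> ((real n + 1) * (- 2 * e) - 2 * (real n + 1 - real r) * \<beta> * (- 1)) / ((- 1) * 1)) at_top"
    by (rule Lim_transform_eventually)
  then show ?thesis
    by (simp add: algebra_simps)
qed

definition mirror_h' :: "real \<Rightarrow> real" where
  "mirror_h' x = (poly (pderiv (mirror (pderiv F))) x * poly (mirror G) x
    - poly (mirror (pderiv F)) x * poly (pderiv (mirror G)) x) / (poly (mirror G) x)\<^sup>2"

lemma mirror_h_deriv: "0 < x \<Longrightarrow> ((\<lambda>x. h (- x)) has_real_derivative mirror_h' x) (at x)"
proof -
  assume "0 < x"
  then have "((\<lambda>x. poly (mirror (pderiv F)) x / poly (mirror G) x) has_real_derivative mirror_h' x) (at x)"
    using mirror_G_pos[of x] unfolding mirror_h'_def power2_eq_square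
    by (intro DERIV_divide poly_DERIV) auto
  then show ?thesis
    by (simp add: h_def)
qed

lemma lim_mirror_h': "((\<lambda>x. mirror_h' x * x ^ (m - n + 1)) \<longlongrightarrow> (real n + 1) * (real m - real n)) at_top"
proof -
  let ?a = "\<lambda>x. poly (mirror (pderiv F)) x / x ^ n" and ?a' = "\<lambda>x. poly (pderiv (mirror (pderiv F))) x / x ^ (n - 1)"
  let ?b = "\<lambda>x. poly (mirror G) x / x ^ m" and ?b' = "\<lambda>x. poly (pderiv (mirror G)) x / x ^ (m - 1)"
  have "((\<lambda>x. (?a' x * ?b x - ?a x * ?b' x) / (?b x)\<^sup>2) \<longlongrightarrow> (- ((real n + 1) * real n) * 1 - (- (real n + 1)) * real m) / 1\<^sup>2) at_top"
    by (intro tendsto_intros lim_mirror_F' lim_mirror_F'' lim_mirror_G lim_mirror_G') auto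
  moreover have "\<forall>\<^sub>F x in at_top. (?a' x * ?b x - ?a x * ?b' x) / (?b x)\<^sup>2 = mirror_h' x * x ^ (m - n + 1)"
    using eventually_gt_at_top[of 0]
  proof eventually_elim
    case (elim x)
    have "poly (mirror G) x \<noteq> 0" "x ^ (n - 1) \<noteq> 0" "x ^ (m - 1) \<noteq> 0" "x \<noteq> 0"
      using mirror_G_pos[OF elim] elim by auto
    moreover have "x ^ n = x * x ^ (n - 1)" "x ^ m = x * x ^ (m - 1)"
      using n m by (simp_all add: odd_pos flip: power_Suc)
    moreover have "m - n + 1 = m - (n - 1)" "n - 1 \<le> m"
      using m_gt n by (cases n; simp)+
    then have "x ^ (m - n + 1) = x ^ m / x ^ (n - 1)"
      using elim by (simp only: power_diff)
    moreover have "x ^ m = x * x ^ (m - 1)"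
      using m by (simp add: odd_pos flip: power_Suc)
    ultimately show ?case
      unfolding mirror_h'_def by (simp only: quotient_rule_scaled simp_thms)
  qed
  ultimately have "((\<lambda>x. mirror_h' x * x ^ (m - n + 1)) \<longlongrightarrow> (- ((real n + 1) * real n) * 1 - (- (real n + 1)) * real m) / 1\<^sup>2) at_top"
    by (rule Lim_transform_eventually)
  then show ?thesis
    by (simp add: algebra_simps)
qed

text \<open>\<open>opposite x = - \<alpha>(F x)\<close>, the mirrored second solution of \<open>F = F x\<close>.\<close>

definition opposite :: "real \<Rightarrow> real" where
  "opposite x = omega (mirror F) (poly F x)"

lemma opposite_at_top: "filterlim opposite at_top at_top"
  unfolding opposite_def by (rule filterlim_compose[OF left.omega_at_top F_at_top])

lemma mirror_F_opposite: "0 \<le> x \<Longrightarrow> poly (mirror F) (opposite x) = poly F x"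
  using right.poly_less[of 0 x] F_0 left.at_0 by (cases "x = 0") (auto simp: opposite_def intro!: left.poly_omega simp del: poly_mirror)

text \<open>Both \<open>F\<close> at \<open>x\<close> and its mirror at \<open>opposite x\<close>
  have the same value and are asymptotic to the power \<open>n + 1\<close> of their arguments;
  taking roots compares the arguments.\<close>

lemma opposite_ratio: "((\<lambda>x. opposite x / x) \<longlongrightarrow> 1) at_top"
proof -
  have "((\<lambda>x. (poly F x / x ^ (n + 1)) / (poly (mirror F) (opposite x) / opposite x ^ (n + 1))) \<longlongrightarrow> 1 / 1) at_top"
    by (intro tendsto_intros lim_F filterlim_compose[OF lim_mirror_F opposite_at_top]) auto
  then have "((\<lambda>x. ((poly F x / x ^ (n + 1)) / (poly (mirror F) (opposite x) / opposite x ^ (n + 1))) powr (1 / (real n + 1))) \<longlongrightarrow> (1 / 1) powr (1 / (real n + 1))) at_top"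
    by (intro tendsto_powr tendsto_const) auto
  moreover have "\<forall>\<^sub>F x in at_top. ((poly F x / x ^ (n + 1)) / (poly (mirror F) (opposite x) / opposite x ^ (n + 1))) powr (1 / (real n + 1)) = opposite x / x"
    using eventually_gt_at_top[of 0] filterlim_at_top_dense[THEN iffD1, OF opposite_at_top, rule_format, of 0]
  proof eventually_elim
    case (elim x)
    have "(poly F x / x ^ (n + 1)) / (poly (mirror F) (opposite x) / opposite x ^ (n + 1)) = (opposite x / x) ^ (n + 1)"
      using mirror_F_opposite[of x] right.poly_less[of 0 x] F_0 elim by (simp add: power_divide del: poly_mirror)
    also have "\<dots> = (opposite x / x) powr (real n + 1)"
      using elim powr_realpow[of "opposite x / x" "n + 1"] by (simp add: add.commute)
    also have "\<dots> powr (1 / (real n + 1)) = opposite x / x"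
      using elim by (simp add: powr_powr)
    finally show ?case .
  qed
  ultimately show ?thesis
    by (simp add: tendsto_cong)
qed

text \<open>Since \<open>mirror F\<close> at \<open>opposite x\<close> equals \<open>F\<close> at
  \<open>x\<close>, the mean value theorem writes \<open>F x - F (- x)\<close>, of leading term
  \<open>2 * \<beta> * x ^ (n + 1 - r)\<close> when \<open>\<beta>\<close> is nonzero, as
  \<open>opposite x - x\<close> times a derivative asymptotic to
  \<open>(n + 1) * x ^ n\<close>.\<close>

lemma lim_opposite_diff: "((\<lambda>x. (opposite x - x) * x ^ r / x) \<longlongrightarrow> 2 * \<beta> / (real n + 1)) at_top"
proof -
  obtain \<xi> where \<xi>: "filterlim \<xi> at_top at_top" "((\<lambda>x. \<xi> x / x) \<longlongrightarrow> 1) at_top"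
    "\<forall>\<^sub>F x in at_top. poly (mirror F) (opposite x) - poly (mirror F) x = (opposite x - x) * poly (pderiv (mirror F)) (\<xi> x)"
    using mean_value_point_tendsto[OF poly_DERIV opposite_at_top opposite_ratio] by blast
  have "((\<lambda>x. - (poly (mirror (pderiv F)) x / x ^ n)) \<longlongrightarrow> real n + 1) at_top"
    using tendsto_minus[OF lim_mirror_F'] by (simp add: add.commute)
  then have "((\<lambda>x. poly (pderiv (mirror F)) x / x ^ n) \<longlongrightarrow> real n + 1) at_top"
    by (simp add: pderiv_mirror del: poly_mirror)
  from filterlim_compose[OF this \<xi>(1)]
  have "((\<lambda>x. (x ^ r * (poly F x - poly (mirror F) x) / x ^ (n + 1)) / ((poly (pderiv (mirror F)) (\<xi> x) / \<xi> x ^ n) * (\<xi> x / x) ^ n))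
      \<longlongrightarrow> 2 * \<beta> / ((real n + 1) * 1 ^ n)) at_top"
    by (intro tendsto_intros lim_F_odd \<xi>(2)) auto
  moreover have "\<forall>\<^sub>F x in at_top. (x ^ r * (poly F x - poly (mirror F) x) / x ^ (n + 1))
      / ((poly (pderiv (mirror F)) (\<xi> x) / \<xi> x ^ n) * (\<xi> x / x) ^ n) = (opposite x - x) * x ^ r / x"
    using \<xi>(3) eventually_gt_at_top[of 0] filterlim_at_top_dense[THEN iffD1, OF \<xi>(1), rule_format, of 0]
  proof eventually_elim
    case (elim x)
    define d where "d = poly (pderiv (mirror F)) (\<xi> x)"
    have "0 < d"
      unfolding d_def by (rule left.pderiv_pos[OF elim(3)])
    have diff: "poly F x - poly (mirror F) x = (opposite x - x) * d"
      using elim mirror_F_opposite[of x] by (simp add: d_def)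
    have "(d / \<xi> x ^ n) * (\<xi> x / x) ^ n = d / x ^ n"
      using elim(3) by (simp add: power_divide)
    then show ?case
      using elim(2) \<open>0 < d\<close> unfolding diff d_def[symmetric] by simp
  qed
  ultimately show ?thesis
    by (simp add: tendsto_cong)
qed

definition K :: real where
  "K = \<beta> * (real m + 1 - real r) - e * (real n + 1)"

text \<open>Two effects add up: the asymmetry of \<open>h\<close> itself and the displacement of the
  opposite root from \<open>- x\<close>. Both involve \<open>\<beta>\<close>, with factors
  \<open>n + 1 - r\<close> and \<open>m - n\<close>, whose sum is the factor
  \<open>m + 1 - r\<close> in \<open>K\<close>.\<close>

lemma lim_h_opposite: "((\<lambda>x. (h x - h (- opposite x)) * x ^ (m - n + r)) \<longlongrightarrow> - 2 * K) at_top"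
proof -
  obtain \<xi> where \<xi>: "filterlim \<xi> at_top at_top" "((\<lambda>x. \<xi> x / x) \<longlongrightarrow> 1) at_top"
    "\<forall>\<^sub>F x in at_top. h (- opposite x) - h (- x) = (opposite x - x) * mirror_h' (\<xi> x)"
    using mean_value_point_tendsto[OF mirror_h_deriv opposite_at_top opposite_ratio] by blast
  have "((\<lambda>x. (h x - h (- x)) * x ^ (m - n + r)
        - ((opposite x - x) * x ^ r / x) * (mirror_h' (\<xi> x) * \<xi> x ^ (m - n + 1)) / (\<xi> x / x) ^ (m - n + 1))
      \<longlongrightarrow> (2 * (real n + 1) * e - 2 * (real n + 1 - real r) * \<beta>) - (2 * \<beta> / (real n + 1)) * ((real n + 1) * (real m - real n)) / 1 ^ (m - n + 1)) at_top"
    by (intro tendsto_intros lim_h_diff lim_opposite_diff filterlim_compose[OF lim_mirror_h' \<xi>(1)] \<xi>(2)) auto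
  also have "(2 * (real n + 1) * e - 2 * (real n + 1 - real r) * \<beta>) - (2 * \<beta> / (real n + 1)) * ((real n + 1) * (real m - real n)) / 1 ^ (m - n + 1) = - 2 * K"
    by (simp add: K_def field_simps)
  finally show ?thesis
  proof (rule Lim_transform_eventually)
    show "\<forall>\<^sub>F x in at_top. (h x - h (- x)) * x ^ (m - n + r)
        - ((opposite x - x) * x ^ r / x) * (mirror_h' (\<xi> x) * \<xi> x ^ (m - n + 1)) / (\<xi> x / x) ^ (m - n + 1)
      = (h x - h (- opposite x)) * x ^ (m - n + r)"
      using \<xi>(3) eventually_gt_at_top[of 0] filterlim_at_top_dense[THEN iffD1, OF \<xi>(1), rule_format, of 0]
    proof eventually_elim
      case (elim x)
      have "((opposite x - x) * x ^ r / x) * (mirror_h' (\<xi> x) * \<xi> x ^ (m - n + 1)) / (\<xi> x / x) ^ (m - n + 1)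
          = ((opposite x - x) * mirror_h' (\<xi> x)) * x ^ (m - n + r)"
        using elim(2,3) by (simp add: power_divide power_add)
      then show ?case
        unfolding elim(1)[symmetric] by (simp add: algebra_simps)
    qed
  qed
qed

text \<open>The decay exponent of the derivatives of \<open>I_minus\<close> and
  \<open>I_plus\<close> in \<open>y\<close>. The condition \<open>1 < \<gamma>\<close> is exactly
  \<open>2 * n + 1 < m\<close>.\<close>

definition \<gamma> :: real where
  "\<gamma> = (real m - real n) / (real n + 1)"

text \<open>A root \<open>x = \<omega>(y)\<close> of \<open>F x = y\<close> satisfies \<open>y / x\<^bsup>n+1\<^esup> \<longlongrightarrow> 1\<close>, so powers of \<open>x\<close> may be
  replaced by powers of \<open>y\<close>.\<close>

lemma omega_tendsto:
  assumes "increasing_poly p" and p: "((\<lambda>x. poly p x / x ^ (n + 1)) \<longlongrightarrow> 1) at_top"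
    and u: "((\<lambda>x. u x * x ^ k) \<longlongrightarrow> l) at_top"
  shows "((\<lambda>y. u (omega p y) * y powr (k / (real n + 1))) \<longlongrightarrow> l) at_top"
proof -
  interpret p: increasing_poly p
    by fact
  have "((\<lambda>y. (u (omega p y) * omega p y ^ k) * (poly p (omega p y) / omega p y ^ (n + 1)) powr (k / (real n + 1))) \<longlongrightarrow> l * 1 powr (k / (real n + 1))) at_top"
    using filterlim_compose[OF u p.omega_at_top] filterlim_compose[OF p p.omega_at_top]
    by (intro tendsto_intros) auto
  then have "((\<lambda>y. (u (omega p y) * omega p y ^ k) * (poly p (omega p y) / omega p y ^ (n + 1)) powr (k / (real n + 1))) \<longlongrightarrow> l) at_top"
    by simp
  then show ?thesis
  proof (rule Lim_transform_eventually)
    show "\<forall>\<^sub>F y in at_top. (u (omega p y) * omega p y ^ k) * (poly p (omega p y) / omega p y ^ (n + 1)) powr (k / (real n + 1))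
        = u (omega p y) * y powr (k / (real n + 1))"
      using eventually_gt_at_top[of 0]
    proof eventually_elim
      case (elim y)
      define x where "x = omega p y"
      have x: "0 < x" "poly p x = y"
        using p.omega_pos[OF elim] p.poly_omega[of y] elim by (auto simp: x_def)
      have "(x ^ (n + 1)) powr (k / (real n + 1)) = x ^ k"
        using x by (simp add: powr_powr add.commute flip: powr_realpow del: power_Suc)
      then show ?case
        using x elim unfolding x_def[symmetric] by (subst powr_divide) auto
    qed
  qed
qed

lemma I_minus'_lim: "((\<lambda>y. h (omega F y) * y powr \<gamma>) \<longlongrightarrow> - (real n + 1)) at_top"
  using omega_tendsto[OF right.increasing_poly_axioms lim_F lim_h] m_gt by (simp add: \<gamma>_def of_nat_diff)

lemma I_plus'_lim: "((\<lambda>y. h (- omega (mirror F) y) * y powr \<gamma>) \<longlongrightarrow> - (real n + 1)) at_top"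
  using omega_tendsto[OF left.increasing_poly_axioms lim_mirror_F lim_mirror_h] m_gt
  by (simp add: \<gamma>_def of_nat_diff)

lemma I'_lim:
  "((\<lambda>y. (h (omega F y) - h (- omega (mirror F) y)) * y powr (\<gamma> + r / (real n + 1))) \<longlongrightarrow> - 2 * K) at_top"
proof (rule Lim_transform_eventually[OF omega_tendsto[OF right.increasing_poly_axioms lim_F lim_h_opposite]])
  have exponent: "real (m - n + r) / (real n + 1) = \<gamma> + r / (real n + 1)"
    using m_gt by (simp add: \<gamma>_def of_nat_diff add_divide_distrib[symmetric])
  show "\<forall>\<^sub>F y in at_top. (h (omega F y) - h (- opposite (omega F y))) * y powr (real (m - n + r) / (real n + 1))
      = (h (omega F y) - h (- omega (mirror F) y)) * y powr (\<gamma> + r / (real n + 1))"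
    using eventually_ge_at_top[of 0]
    by eventually_elim (simp add: opposite_def right.poly_omega exponent[simplified])
qed

lemma orbits:
  assumes lim: "(slow_div_integral F G \<longlongrightarrow> 0) at_top"
  defines "d \<equiv> real r * (real m + 1) / (real r * (real m + 1) + 2 * (real n + 1))"
  shows "K < 0 \<Longrightarrow> large_orbits_have_dim m (slow_rel F G) d"
    and "K > 0 \<Longrightarrow> large_orbits_have_dim m (slow_rel_inv F G) d"
proof -
  have \<gamma>: "1 < \<gamma>"
    using m_gt by (simp add: \<gamma>_def field_simps)
  have \<rho>: "0 < r / (real n + 1)"
    using r by (auto intro!: divide_pos_pos elim: oddE)
  \<comment> \<open>With \<open>\<rho> = r / (n + 1)\<close> and
    \<open>\<kappa> = 2 / (m + 1)\<close>, the value \<open>\<rho> / (\<rho> + \<kappa>)\<close>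
    found for orbits is \<open>d\<close>.\<close>
  have "r / (real n + 1) + 2 / (real m + 1)
      = (real r * (real m + 1) + 2 * (real n + 1)) / ((real n + 1) * (real m + 1))"
    by (simp add: divide_simps)
  then have d: "d = (r / (real n + 1)) / (r / (real n + 1) + 2 / (real m + 1))"
    by (simp add: d_def)
  have lim': "((\<lambda>y. I_minus F G y - I_plus F G y) \<longlongrightarrow> 0) at_top"
    using lim by (simp add: slow_div_integral_def[abs_def])
  show "large_orbits_have_dim m (slow_rel F G) d" if "K < 0"
  proof -
    \<comment> \<open>For \<open>K < 0\<close> the slow divergence integral eventually increases to
      0, so \<open>I_minus\<close> lies below \<open>I_plus\<close> there and
      \<open>slow_rel\<close> moves large points upwards.\<close>
    have "slow_relation (I_minus F G) (I_plus F G) (\<lambda>y. h (omega F y)) (\<lambda>y. h (- omega (mirror F) y))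
        (slow_rel F G) \<gamma> (r / (real n + 1)) (real n + 1) (- 2 * K)"
      using \<gamma> \<rho> that lim' I_minus_deriv I_plus_deriv I_plus_antimono I_plus'_lim I'_lim slow_rel[OF lim]
      by unfold_locales (auto simp: h_def)
    from slow_relation.large_orbits_have_dim[OF this] show ?thesis
      by (simp add: d)
  qed
  show "large_orbits_have_dim m (slow_rel_inv F G) d" if "K > 0"
  proof -
    \<comment> \<open>For \<open>K > 0\<close> the two integrals exchange roles, and the inverse
      relation moves large points upwards.\<close>
    have "slow_relation (I_plus F G) (I_minus F G) (\<lambda>y. h (- omega (mirror F) y)) (\<lambda>y. h (omega F y))
        (slow_rel_inv F G) \<gamma> (r / (real n + 1)) (real n + 1) (2 * K)"
      using \<gamma> \<rho> that tendsto_minus[OF lim'] I_minus_deriv I_plus_deriv I_minus_antimono I_minus'_lim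
        tendsto_minus[OF I'_lim] slow_rel_inv[OF lim]
      by unfold_locales (auto simp: h_def left_diff_distrib)
    from slow_relation.large_orbits_have_dim[OF this] show ?thesis
      by (simp add: d)
  qed
qed

end

section \<open>Parity of the degrees and the choice of \<open>r\<close>\<close>

lemma poly_at_top:
  fixes p :: "real poly"
  assumes "((\<lambda>x. poly p x / x ^ d) \<longlongrightarrow> 1) at_top" and "0 < d"
  shows "filterlim (poly p) at_top at_top"
proof -
  have "filterlim (\<lambda>x. poly p x / x ^ d * x ^ d) at_top at_top"
    by (rule filterlim_tendsto_pos_mult_at_top[OF assms(1) _ filterlim_pow_at_top[OF assms(2) filterlim_ident]]) simp
  then show ?thesis
    by (rule filterlim_mono_eventually[OF _ order_refl order_refl])
      (rule eventually_mono[OF eventually_gt_at_top[of 0]], simp)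
qed

text \<open>The parity of the degree is read off the signs at both ends.\<close>

lemma coeff_nonneg_of_poly_pos:
  fixes p :: "real poly"
  assumes "\<And>x. 0 < x \<Longrightarrow> 0 < poly p x" and "degree p \<le> d"
  shows "0 \<le> coeff p d"
proof (rule tendsto_lowerbound[OF poly_div_power_tendsto[OF assms(2)]])
  show "\<forall>\<^sub>F x in at_top. 0 \<le> poly p x / x ^ d"
    using eventually_gt_at_top[of 0] by eventually_elim (simp add: assms(1) less_imp_le)
qed simp

text \<open>For \<open>x > 0\<close> the values \<open>- F' (- x)\<close>, \<open>- G x\<close> and
  \<open>G (- x)\<close> are positive, so their top coefficients are nonnegative. In turn this gives
  that \<open>n\<close> is odd, that \<open>A = 1\<close>, and that \<open>m\<close> is odd.\<close>

lemma normal_form: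
  fixes F G :: "real poly" and A :: real and b a :: "nat \<Rightarrow> real"
  assumes F_eq: "F = monom 1 (n + 1) + (\<Sum>k\<le>n. monom (b k) k)"
    and G_eq: "G = - monom A m - (\<Sum>k<m. monom (a k) k)"
    and A_norm: "A = 1 \<or> A = - 1"
    and F_zero: "poly F 0 = 0" "poly (pderiv F) 0 = 0"
    and F_pos: "\<forall>x. poly (pderiv F div [:0, 1:]) x > 0"
    and G_zero: "poly G 0 = 0"
    and G_neg: "\<forall>x. poly (G div [:0, 1:]) x < 0"
  shows "odd n" "odd m" "A = 1" "lienard F G (pderiv F div [:0, 1:]) (G div [:0, 1:])"
    "\<And>k. coeff F k = (if k = n + 1 then 1 else if k \<le> n then b k else 0)"
    "\<And>k. coeff G k = (if k = m then - A else if k < m then - a k else 0)"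
proof -
  define f g where "f = pderiv F div [:0, 1:]" and "g = G div [:0, 1:]"
  have "[:0, 1:] dvd p" if "poly p 0 = 0" for p :: "real poly"
    using that poly_eq_0_iff_dvd[of p 0] by simp
  then have F_factor: "pderiv F = [:0, 1:] * f" and G_factor: "G = [:0, 1:] * g"
    using F_zero(2) G_zero unfolding f_def g_def by (metis dvd_mult_div_cancel)+
  show coeff_F: "coeff F k = (if k = n + 1 then 1 else if k \<le> n then b k else 0)" for k
    by (simp add: F_eq coeff_sum)
  show coeff_G: "coeff G k = (if k = m then - A else if k < m then - a k else 0)" for k
    by (simp add: G_eq coeff_sum)
  have F'_neg: "0 < poly (- mirror (pderiv F)) x" and G_neg': "0 < poly (- G) x" and G_pos: "0 < poly (mirror G) x"
    if "0 < x" for x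
    using that F_pos G_neg unfolding f_def[symmetric] g_def[symmetric]
    by (simp_all add: F_factor G_factor mult_pos_neg)
  have "0 \<le> coeff (- mirror (pderiv F)) n"
    by (rule coeff_nonneg_of_poly_pos[OF F'_neg]) (auto intro!: degree_le simp: coeff_pderiv coeff_F)
  then show n: "odd n"
    by (auto simp: coeff_pderiv coeff_F)
  have "0 \<le> coeff (- G) m"
    by (rule coeff_nonneg_of_poly_pos[OF G_neg']) (auto intro!: degree_le simp: coeff_G)
  then show A: "A = 1"
    using A_norm by (auto simp: coeff_G)
  have "0 \<le> coeff (mirror G) m"
    by (rule coeff_nonneg_of_poly_pos[OF G_pos]) (auto intro!: degree_le simp: coeff_G)
  then show "odd m"
    by (auto simp: coeff_G A)
  have deg: "degree F \<le> n + 1" "degree (mirror F) \<le> n + 1"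
    by (auto intro!: degree_le simp: coeff_F)
  have at_top: "filterlim (poly F) at_top at_top" "filterlim (poly (mirror F)) at_top at_top"
    using deg[THEN poly_div_power_tendsto] n by (auto intro!: poly_at_top[of _ "n + 1"] simp: coeff_F simp del: poly_mirror)
  show "lienard F G (pderiv F div [:0, 1:]) (G div [:0, 1:])"
    using lienard.intro[OF F_zero(1) F_factor G_factor _ _ at_top] F_pos G_neg unfolding f_def g_def by blast
qed

theorem theorem2p3:
  fixes n m :: nat and A :: real and a b :: "nat \<Rightarrow> real" and F G :: "real poly"
  assumes "n \<ge> 1" and "m \<ge> 1"
    and F_eq: "F = monom 1 (n + 1) + (\<Sum>k\<le>n. monom (b k) k)"
    and G_eq: "G = - monom A m - (\<Sum>k<m. monom (a k) k)"
    and A_norm: "even m \<Longrightarrow> A = 1" "odd m \<Longrightarrow> A = 1 \<or> A = - 1"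
    and F_zero: "poly F 0 = 0" "poly (pderiv F) 0 = 0"
    and F_pos: "\<forall>x. poly (pderiv F div [:0, 1:]) x > 0"
    and G_zero: "poly G 0 = 0"
    and G_neg: "\<forall>x. poly (G div [:0, 1:]) x < 0"
    and ja_or_jb: "even_support m a \<noteq> {} \<or> odd_support n b \<noteq> {}"
    and m_gt: "m > 2 * n + 1"
    and I_infinity: "(slow_div_integral F G \<longlongrightarrow> 0) at_top"
  defines "p \<equiv> real n - 2 * real (jb n b)"
    and "q \<equiv> real m - 2 * real (ja m a)"
    and "B \<equiv> b (2 * jb n b + 1)"
    and "E \<equiv> a (2 * ja m a)"
  defines "dp \<equiv> p * (real m + 1) / (p * (real m + 1) + 2 * (real n + 1))"
    and "dq \<equiv> q * (real m + 1) / (q * (real m + 1) + 2 * (real n + 1))"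
    and "C \<equiv> B * (real m - real n + 2 * real (jb n b) + 1) - E * (real n + 1)"
  shows
    "((odd_support n b \<noteq> {} \<and> even_support m a \<noteq> {} \<and> p < q) \<or> even_support m a = {} \<longrightarrow>
        (B < 0 \<longrightarrow> large_orbits_have_dim m (slow_rel F G) dp) \<and>
        (B > 0 \<longrightarrow> large_orbits_have_dim m (slow_rel_inv F G) dp))
   \<and> ((odd_support n b \<noteq> {} \<and> even_support m a \<noteq> {} \<and> p > q) \<or> odd_support n b = {} \<longrightarrow>
        (E > 0 \<longrightarrow> large_orbits_have_dim m (slow_rel F G) dq) \<and>
        (E < 0 \<longrightarrow> large_orbits_have_dim m (slow_rel_inv F G) dq))
   \<and> (odd_support n b \<noteq> {} \<and> even_support m a \<noteq> {} \<and> p = q \<and> C \<noteq> 0 \<longrightarrow>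
        (C < 0 \<longrightarrow> large_orbits_have_dim m (slow_rel F G) dp) \<and>
        (C > 0 \<longrightarrow> large_orbits_have_dim m (slow_rel_inv F G) dp) \<and>
        dp = dq)"
proof -
  have "A = 1 \<or> A = - 1"
    using A_norm by blast
  note normal = normal_form[OF F_eq G_eq this F_zero F_pos G_zero G_neg]
  note n = normal(1) and m = normal(2) and coeff_F = normal(5) and coeff_G = normal(6)[unfolded normal(3)]
  have fin: "finite (odd_support n b)" "finite (even_support m a)"
    by (rule finite_subset[of _ "{..n}"], auto simp: odd_support_def)
      (rule finite_subset[of _ "{..m}"], auto simp: even_support_def)
  have jb: "2 * jb n b + 1 \<le> n" "B \<noteq> 0" if "odd_support n b \<noteq> {}"
    using Max_in[OF fin(1) that] by (auto simp: odd_support_def jb_def B_def)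
  have ja: "2 * ja m a + 1 \<le> m" "E \<noteq> 0" if "even_support m a \<noteq> {}"
    using Max_in[OF fin(2) that] by (auto simp: even_support_def ja_def E_def)
  \<comment> \<open>The last premise is vacuous if the support is empty, so the same rule also
    covers the case that all odd coefficients vanish; likewise for \<open>a_zero\<close>.\<close>
  have b_zero: "b k = 0" if "odd k" "k \<le> n" "odd_support n b \<noteq> {} \<Longrightarrow> 2 * jb n b + 1 < k" for k
  proof (rule ccontr)
    assume "b k \<noteq> 0"
    then have "k div 2 \<in> odd_support n b"
      using that by (auto simp: odd_support_def elim!: oddE)
    then have "2 * jb n b + 1 < k" "k div 2 \<le> jb n b"
      using Max_ge[OF fin(1)] that(3) by (auto simp: jb_def)
    then show False
      using \<open>odd k\<close> by presburger
  qed
  have a_zero: "a k = 0" if "even k" "k < m" "even_support m a \<noteq> {} \<Longrightarrow> 2 * ja m a < k" for k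
  proof (rule ccontr)
    assume "a k \<noteq> 0"
    then have "k div 2 \<in> even_support m a"
      using that by (auto simp: even_support_def)
    then have "2 * ja m a < k" "k div 2 \<le> ja m a"
      using Max_ge[OF fin(2)] that(3) by (auto simp: ja_def)
    then show False
      using \<open>even k\<close> by presburger
  qed
  \<comment> \<open>Here \<open>r\<close> need only be an odd distance at which no earlier
    asymmetric coefficient has been passed. The two coefficients at that distance may be 0; the sign
    of \<open>K\<close> alone decides.\<close>
  have orbits: "(K < 0 \<longrightarrow> large_orbits_have_dim m (slow_rel F G) d) \<and> (K > 0 \<longrightarrow> large_orbits_have_dim m (slow_rel_inv F G) d)"
    if r: "odd r" "odd_support n b \<noteq> {} \<Longrightarrow> 2 * jb n b + r \<le> n" "even_support m a \<noteq> {} \<Longrightarrow> 2 * ja m a + r \<le> m"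
      "r \<le> m"
    and K: "K = (if n < r then 0 else b (n + 1 - r)) * (real m + 1 - r) - a (m - r) * (real n + 1)"
    and d: "d = real r * (real m + 1) / (real r * (real m + 1) + 2 * (real n + 1))" for r :: nat and K d :: real
  proof -
    interpret lienard F G "pderiv F div [:0, 1:]" "G div [:0, 1:]"
      by (rule normal(4))
    interpret lienard_asymptotics F G "pderiv F div [:0, 1:]" "G div [:0, 1:]" n m r
      "if n < r then 0 else b (n + 1 - r)" "a (m - r)"
    proof
      show "coeff F k = 0" if k: "odd k" "n + 1 < k + r" for k
      proof -
        have "b k = 0" if "k \<le> n"
          using k that r(2) by (intro b_zero) linarith+
        moreover have "k \<noteq> n + 1"
          using k n by auto
        ultimately show ?thesis
          by (simp add: coeff_F)
      qed
      show "coeff G k = 0" if k: "even k" "m < k + r" for k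
      proof -
        have "a k = 0" if "k < m"
          using k that r(3) by (intro a_zero) linarith+
        moreover have "k \<noteq> m"
          using k m by auto
        ultimately show ?thesis
          by (simp add: coeff_G)
      qed
      \<comment> \<open>The guards \<open>n < r\<close> and \<open>n + 1 < r\<close> agree, because
        \<open>r\<close> is odd and \<open>n + 1\<close> is even.\<close>
      show "(if n < r then 0 else b (n + 1 - r)) = (if n + 1 < r then 0 else coeff F (n + 1 - r))"
      proof (cases "n < r")
        case True
        then have "n + 1 < r"
          using n r(1) by (cases "r = n + 1") auto
        with True show ?thesis
          by simp
      qed (use odd_pos[OF r(1)] in \<open>auto simp: coeff_F\<close>)
      show "a (m - r) = - (if m < r then 0 else coeff G (m - r))"
        using r(4) odd_pos[OF r(1)] by (auto simp: coeff_G)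
    qed (use n m r(1) m_gt in \<open>simp_all add: coeff_F coeff_G\<close>)
    show ?thesis
      using orbits[OF I_infinity] by (simp add: K d K_def)
  qed
  have p_case: "(K < 0 \<longrightarrow> large_orbits_have_dim m (slow_rel F G) dp) \<and> (K > 0 \<longrightarrow> large_orbits_have_dim m (slow_rel_inv F G) dp)"
    if odd: "odd_support n b \<noteq> {}" and le: "even_support m a \<noteq> {} \<Longrightarrow> p \<le> q"
      and K: "K = B * (real m + 1 - p) - (if even_support m a \<noteq> {} \<and> p = q then E else 0) * (real n + 1)" for K
  proof (rule orbits)
    let ?r = "n - 2 * jb n b"
    have r: "real ?r = p" "?r \<le> n"
      using jb[OF odd] by (simp_all add: p_def)
    show "odd ?r"
      using n jb[OF odd] by simp
    show "?r \<le> m" "2 * jb n b + ?r \<le> n"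
      using m_gt jb[OF odd] by auto
    show "2 * ja m a + ?r \<le> m" if "even_support m a \<noteq> {}"
      using le[OF that] unfolding r(1)[symmetric] q_def by linarith
    \<comment> \<open>At distance \<open>n - 2 * jb n b\<close> the polynomial \<open>G\<close>
      contributes only in the case of equality; otherwise the index lies beyond
      \<open>2 * ja m a\<close>, or all even coefficients vanish.\<close>
    have "a (m - ?r) = (if even_support m a \<noteq> {} \<and> p = q then E else 0)"
    proof (cases "even_support m a \<noteq> {} \<and> p = q")
      case True
      then have "m - ?r = 2 * ja m a"
        using ja[of] unfolding r(1)[symmetric] q_def by linarith
      with True show ?thesis
        by (simp add: E_def)
    next
      case False
      have "a (m - ?r) = 0"
      proof (rule a_zero)
        show "even (m - ?r)" "m - ?r < m"
          using m n jb[OF odd] m_gt by auto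
        show "2 * ja m a < m - ?r" if "even_support m a \<noteq> {}"
          using that False le[OF that] ja(1)[OF that] unfolding r(1)[symmetric] q_def by linarith
      qed
      with False show ?thesis
        by auto
    qed
    moreover have "n + 1 - ?r = 2 * jb n b + 1"
      using jb[OF odd] by simp
    moreover have "\<not> n < ?r"
      by simp
    ultimately show "K = (if n < ?r then 0 else b (n + 1 - ?r)) * (real m + 1 - ?r) - a (m - ?r) * (real n + 1)"
      unfolding K B_def r(1) by simp
    show "dp = real ?r * (real m + 1) / (real ?r * (real m + 1) + 2 * (real n + 1))"
      by (simp add: dp_def r)
  qed
  have q_case: "(- E < 0 \<longrightarrow> large_orbits_have_dim m (slow_rel F G) dq) \<and> (- E > 0 \<longrightarrow> large_orbits_have_dim m (slow_rel_inv F G) dq)"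
    if even: "even_support m a \<noteq> {}" and less: "odd_support n b \<noteq> {} \<Longrightarrow> q < p"
  proof -
    let ?r = "m - 2 * ja m a"
    have r: "real ?r = q" "?r \<le> m"
      using ja[OF even] by (simp_all add: q_def)
    \<comment> \<open>At distance \<open>m - 2 * ja m a\<close> the contribution of \<open>F\<close>
      vanishes, as its first odd coefficient, if any, lies strictly lower. So \<open>K\<close>
      reduces to this multiple of \<open>E\<close>, which reverses the sign.\<close>
    have "(- E * (real n + 1) < 0 \<longrightarrow> large_orbits_have_dim m (slow_rel F G) dq)
      \<and> (- E * (real n + 1) > 0 \<longrightarrow> large_orbits_have_dim m (slow_rel_inv F G) dq)"
    proof (rule orbits)
      show "odd ?r"
        using m ja[OF even] by simp
      show "?r \<le> m" "2 * ja m a + ?r \<le> m"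
        using ja[OF even] by auto
      show "2 * jb n b + ?r \<le> n" if "odd_support n b \<noteq> {}"
        using less[OF that] unfolding r(1)[symmetric] p_def by linarith
      have "b (n + 1 - ?r) = 0" if "?r \<le> n"
      proof (rule b_zero)
        show "odd (n + 1 - ?r)" "n + 1 - ?r \<le> n"
          using m n ja[OF even] that by auto
        show "2 * jb n b + 1 < n + 1 - ?r" if "odd_support n b \<noteq> {}"
          using less[OF that] jb(1)[OF that] unfolding r(1)[symmetric] p_def by linarith
      qed
      moreover have "m - ?r = 2 * ja m a"
        using ja[OF even] by simp
      ultimately show "- E * (real n + 1) = (if n < ?r then 0 else b (n + 1 - ?r)) * (real m + 1 - ?r) - a (m - ?r) * (real n + 1)"
        by (simp add: E_def)
      show "dq = real ?r * (real m + 1) / (real ?r * (real m + 1) + 2 * (real n + 1))"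
        by (simp add: dq_def r)
    qed
    then show ?thesis
      by (simp add: mult_less_0_iff zero_less_mult_iff add_nonneg_pos)
  qed
  \<comment> \<open>Positivity of this factor makes the sign of \<open>B\<close> decide when
    \<open>G\<close> does not contribute.\<close>
  have pos: "0 < real m + 1 - p"
    using m_gt by (simp add: p_def)
  have C_eq: "C = B * (real m + 1 - p) - E * (real n + 1)"
    by (simp add: C_def p_def algebra_simps)
  have p_strict: "(B < 0 \<longrightarrow> large_orbits_have_dim m (slow_rel F G) dp) \<and> (B > 0 \<longrightarrow> large_orbits_have_dim m (slow_rel_inv F G) dp)"
    if "odd_support n b \<noteq> {}" "even_support m a = {} \<or> p < q"
  proof -
    have "B * (real m + 1 - p) = B * (real m + 1 - p) - (if even_support m a \<noteq> {} \<and> p = q then E else 0) * (real n + 1)"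
      using that by auto
    from p_case[OF that(1) _ this] show ?thesis
      using that pos by (auto simp: mult_less_0_iff zero_less_mult_iff)
  qed
  have p_eq: "(C < 0 \<longrightarrow> large_orbits_have_dim m (slow_rel F G) dp) \<and> (C > 0 \<longrightarrow> large_orbits_have_dim m (slow_rel_inv F G) dp)"
    if "odd_support n b \<noteq> {}" "even_support m a \<noteq> {}" "p = q"
    by (rule p_case) (use that C_eq in auto)
  have "dp = dq" if "p = q"
    using that by (simp add: dp_def dq_def)
  with p_strict p_eq q_case ja_or_jb show ?thesis
    by simp blast
qed

end
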